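(* Let $n\ge 2$ be an integer and let $\mu=(\mu_k)_{k\in\mathbb{N}_0}$ be a probability vector with $\mu_0\in(0,1)$. Then $\# V_\mu^c(\mathcal{D}_n)=\infty$ almost surely. Moreover, the following statements are equivalent: (A) Almost surely, $V_\mu(\mathcal{D}_n)$ contains a path of infinite length. (B) With positive probability, the branching process $(Z_m)_{m\ge 0}$ does not die out globally. (C) With positive probability, the branching process $(Z_m)_{m\ge 0}$ does not die out locally. (D) $\rho(M)>n^{-1}$, where $M=(M_{x,y})_{x,y\in\mathcal{Z}}$.
   Context: Notation: $\mathbb{N}=\{1,2,\ldots\}$, $\mathbb{N}_0=\{0,1,2,\ldots\}$, and $\#A\in\mathbb{N}_0\cup\{\infty\}$ is the cardinality of a (countable) set $A$. The tree. $\mathcal{D}_n=(V_n,E_n)$ is the infinite directed $n$-ary tree: $V_n=\bigcup_{m\ge 0}\{1,\ldots,n\}^m$ is the set of finite words over $\{1,\ldots,n\}$, with the empty word $\emptyset$ as root (the only word of length $0$), and $E_n$ consists of all pairs $(x,(x,j))$ with $x\in V_n$, $j\in\{1,\ldots,n\}$, where $(x,j)$ is the word $x$ with the letter $j$ appended (so $(\emptyset,j)$ is identified with $j$). For $x,y\in V_n$, $d(x,y)\in\mathbb{N}_0\cup\{\infty\}$ is the length of the directed path from $x$ to $y$ ($\infty$ if there is none; $d(x,x)=0$). Percolation model. Let $(Y_x)_{x\in V_n}$ be i.i.d. random variables with $\mathbb{P}[Y_x=k]=\mu_k$ for all $k\ge 0$. With $B_k(x)=\{y\in V_n: d(x,y)<k\}$,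 the random sets of covered and uncovered vertices are $$V_\mu(\mathcal{D}_n)=\bigcup_{x\in V_n}B_{Y_x}(x),\qquad V_\mu^c(\mathcal{D}_n)=V_n\setminus V_\mu(\mathcal{D}_n).$$ A path is contained in $V_\mu(\mathcal{D}_n)$ if it is a path in $\mathcal{D}_n$ all of whose vertices lie in $V_\mu(\mathcal{D}_n)$. The matrix $M$. Let $\mathcal{X}=\mathbb{N}_0$ if $\mu$ has unbounded support and $\mathcal{X}=\{0,1,\ldots,n_0\}$ with $n_0=\sup\{k\in\mathbb{N}:\mu_k\ne 0\}$ otherwise; put $\mathcal{Z}=\mathcal{X}\setminus\{0\}$. Let $P=(P_{x,y})_{x,y\in\mathcal{X}}$ be the matrix with $P_{x,y}=\mu_y$ if $y\ge x$, $P_{x,y}=\sum_{z=0}^{x-1}\mu_z$ if $y=x-1$, and $P_{x,y}=0$ if $y\le x-2$. (This is the transition matrix of the Markov chain $X_{m+1}=\max\{X_m-1,Y_{m+1}\}$ with i.i.d. $Y_m$ of law $\mu$.) Set $M_{x,y}:=P_{x,y}$ for $x,y\in\mathcal{Z}$, i.e. $M$ arises from $P$ by deleting the row and column indexed by $0$. The matrix $M$ is irreducible with nonnegative entries, and $\rho(M):=\limsup_{m\to\infty}\big((M^m)_{x,y}\big)^{1/m}$, which does not depend on the choice of $x,y\in\mathcal{Z}$. The branching process. The multitype branching process $(Z_m)_{m\ge 0}$ with type space $\mathcal{Z}$ is defined from the percolation model as follows. A vertex $y\in V_n$ with $d(\emptyset,y)=k$ is an individual of the $k$-th generation if and only if all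 vertices on the directed path from $\emptyset$ to $y$ (both endpoints included) belong to $V_\mu(\mathcal{D}_n)$. The type of such an individual $y$ is $$z_y:=\max\{Y_x-d(x,y) : x\in V_n,\ d(x,y)<\infty\}\in\mathcal{Z}.$$ Thus, if $Y_\emptyset\ge 1$, the process starts with one individual of type $Y_\emptyset$; if $Y_\emptyset=0$ there are no individuals at all. Every individual of type $x\ge 2$ has exactly $n$ children, whose types are independent, each being of type $y\in\mathcal{Z}$ with probability $M_{x,y}$; an individual of type $1$ has $n$ independent potential children, each of which is born with type $z\in\mathcal{Z}$ with probability $M_{1,z}$ and is not born with probability $\mu_0$. The process dies out globally if in some generation the total number of individuals is zero. It dies out locally if, for every $z\in\mathcal{Z}$, only finitely many individuals of type $z$ are ever born (over all generations). *)

theory Defs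
  imports "HOL-Probability.Probability"
begin

text \<open>Vertices are words over the alphabet \<open>{1..n}\<close>; letters are appended on the right and the
  root is the empty list.\<close>

definition verts :: "nat \<Rightarrow> nat list set" where
  "verts n = lists {1..n}"

definition edges :: "nat \<Rightarrow> (nat list \<times> nat list) set" where
  "edges n = {(x, x @ [j]) | x j. x \<in> verts n \<and> j \<in> {1..n}}"

text \<open>The infimum of the empty set in \<^typ>\<open>enat\<close> is \<open>\<infinity>\<close>, so this is \<open>\<infinity>\<close> when there is no
  directed path.\<close>

definition tree_dist :: "nat \<Rightarrow> nat list \<Rightarrow> nat list \<Rightarrow> enat" where
  "tree_dist n x y = (INF m\<in>{m. (x, y) \<in> edges n ^^ m}. enat m)"

definition tree_ball :: "nat \<Rightarrow> nat \<Rightarrow> nat list \<Rightarrow> nat list set" where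
  "tree_ball n k x = {y \<in> verts n. tree_dist n x y < enat k}"

text \<open>Here \<open>Y\<close> is one realisation of the random labels; only its values on \<^term>\<open>verts n\<close> matter.\<close>

definition covered :: "nat \<Rightarrow> (nat list \<Rightarrow> nat) \<Rightarrow> nat list set" where
  "covered n Y = (\<Union>x\<in>verts n. tree_ball n (Y x) x)"

definition uncovered :: "nat \<Rightarrow> (nat list \<Rightarrow> nat) \<Rightarrow> nat list set" where
  "uncovered n Y = verts n - covered n Y"

definition contains_infinite_path :: "nat \<Rightarrow> nat list set \<Rightarrow> bool" where
  "contains_infinite_path n S \<longleftrightarrow>
     (\<exists>p :: nat \<Rightarrow> nat list. \<forall>i. p i \<in> S \<and> (p i, p (Suc i)) \<in> edges n)"

definition state_space :: "nat pmf \<Rightarrow> nat set" where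
  "state_space \<mu> =
     (if bdd_above (set_pmf \<mu>) then {0..Sup {k. 1 \<le> k \<and> pmf \<mu> k \<noteq> 0}} else UNIV)"

definition types :: "nat pmf \<Rightarrow> nat set" where
  "types \<mu> = state_space \<mu> - {0}"

definition trans_matrix :: "nat pmf \<Rightarrow> nat \<Rightarrow> nat \<Rightarrow> real" where
  "trans_matrix \<mu> x y =
     (if x \<le> y then pmf \<mu> y
      else if Suc y = x then (\<Sum>z<x. pmf \<mu> z)
      else 0)"

text \<open>Powers of the (possibly infinite) matrix obtained from \<open>A\<close> by keeping only the rows and
  columns with index in \<open>I\<close>; the entries are meaningful only for \<open>x, y \<in> I\<close>. For substochastic
  \<open>A\<close> all the infinite sums converge.\<close>

primrec mat_pow :: "'i set \<Rightarrow> ('i \<Rightarrow> 'i \<Rightarrow> real) \<Rightarrow> nat \<Rightarrow> 'i \<Rightarrow> 'i \<Rightarrow> real" where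
  "mat_pow I A 0 x y = (if x = y then 1 else 0)"
| "mat_pow I A (Suc m) x y = (\<Sum>\<^sub>\<infinity>z\<in>I. A x z * mat_pow I A m z y)"

text \<open>The common value, over all \<open>x, y \<in> I\<close>, of the limit superior; for nonnegative irreducible
  substochastic matrices it does not depend on \<open>x\<close> and \<open>y\<close>.\<close>

definition conv_rho :: "'i set \<Rightarrow> ('i \<Rightarrow> 'i \<Rightarrow> real) \<Rightarrow> ereal" where
  "conv_rho I A =
     (THE r. \<forall>x\<in>I. \<forall>y\<in>I. limsup (\<lambda>m. ereal (root m (mat_pow I A m x y))) = r)"

text \<open>The matrix \<open>M\<close> is \<^const>\<open>trans_matrix\<close> with row and column \<open>0\<close> deleted.\<close>

definition rho_M :: "nat pmf \<Rightarrow> ereal" where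
  "rho_M \<mu> = conv_rho (types \<mu>) (trans_matrix \<mu>)"

text \<open>In a tree, \<open>v\<close> lies on the directed path from the root to \<open>y\<close> iff \<open>v\<close> is reachable from the
  root and \<open>y\<close> is reachable from \<open>v\<close>.\<close>

definition individuals :: "nat \<Rightarrow> (nat list \<Rightarrow> nat) \<Rightarrow> nat \<Rightarrow> nat list set" where
  "individuals n Y k =
     {y \<in> verts n. tree_dist n [] y = enat k \<and>
        (\<forall>v. ([], v) \<in> (edges n)\<^sup>* \<and> (v, y) \<in> (edges n)\<^sup>* \<longrightarrow> v \<in> covered n Y)}"

text \<open>Integer-valued, since \<open>Y x - d(x, y)\<close> may be negative.\<close>

definition ind_type :: "nat \<Rightarrow> (nat list \<Rightarrow> nat) \<Rightarrow> nat list \<Rightarrow> int" where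
  "ind_type n Y y =
     Max {int (Y x) - int (the_enat (tree_dist n x y)) | x. x \<in> verts n \<and> tree_dist n x y < \<infinity>}"

definition dies_out_globally :: "nat \<Rightarrow> (nat list \<Rightarrow> nat) \<Rightarrow> bool" where
  "dies_out_globally n Y \<longleftrightarrow> (\<exists>m. individuals n Y m = {})"

definition dies_out_locally :: "nat \<Rightarrow> nat pmf \<Rightarrow> (nat list \<Rightarrow> nat) \<Rightarrow> bool" where
  "dies_out_locally n \<mu> Y \<longleftrightarrow>
     (\<forall>z\<in>types \<mu>. finite {y \<in> (\<Union>m. individuals n Y m). ind_type n Y y = int z})"

end

theory Submission
  imports Defs
begin

text \<open>Everything is compared with one scalar criterion. Along a ray, go up from a covered vertex to the
nearest ancestor that covers it. If that ancestor is \<open>k\<close> steps away, the only thing learnt about the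
labels passed on the way is that the one \<open>i\<close> steps away is at most \<open>i\<close>, and nothing at all is learnt
above the ancestor. So covered stretches form a renewal process read upwards: with
\<open>u\<^sub>k = P(Y \<le> 0) \<cdots> P(Y \<le> k - 1)\<close> and \<open>g\<^sub>k = u\<^sub>k P(Y > k)\<close>, the probability \<open>w\<^sub>m\<close> that the first \<open>m\<close>
vertices of a ray are all covered satisfies \<open>w\<^sub>m = \<Sum>k<m. g\<^sub>k w\<^bsub>m-1-k\<^esub>\<close> (\<open>cover_mass_renewal\<close>).
The criterion, \<open>supercritical\<close>, is \<open>\<Sum>k. g\<^sub>k n\<^bsup>k+1\<^esup> > 1\<close>: it says that \<open>n\<^sup>m w\<^sub>m\<close>, the expected size of a
generation, is a renewal sequence whose steps have total mass greater than \<open>1\<close>.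

Suppose the criterion fails. Then \<open>n\<^sup>m w\<^sub>m \<le> 1\<close> for all \<open>m\<close>. Since \<open>M\<^sup>m(1,1) \<le> w\<^sub>m\<close>, this gives
\<open>\<rho>(M) \<le> 1/n\<close>. Survival with positive probability is impossible as well: \<open>n \<ge> 2\<close> independent children
survive with probability \<open>1 - (1 - t)\<^sup>n \<le> n t - t\<^sup>2\<close>, so every generation would lose a fixed
proportion of its expected size against the linear recursion, and these losses add up beyond the
bound \<open>1\<close> (\<open>survival_le_if_not_supercritical\<close>).

Suppose the criterion holds. Finitely many terms \<open>g\<^sub>k\<close> already exceed \<open>1\<close>, and they do so after all
labels above some \<open>N\<close> are forbidden and with some \<open>s < n\<close> in place of \<open>n\<close>. Hence
\<open>s\<^sup>m w\<^sub>m\<close> stays away from \<open>0\<close> in the truncated model, which only uses the finite matrix on the types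
\<open>1, \<dots>, N\<close>; one of its entries must then grow like \<open>s\<^bsup>-m\<^esup>\<close>, so \<open>\<rho>(M) \<ge> 1/s > 1/n\<close>. Moreover a small
multiple of \<open>\<Sum>m<L. s\<^sup>m w\<^sub>m\<close>, with \<open>w\<^sub>m\<close> as a function of the type, is a subsolution of the recursion
for survival probabilities (\<open>supercritical_survival\<close>), so the truncated process survives. As it has
finitely many types, one of them occurs infinitely often, which is local survival; and local
survival implies global survival because generations are finite.

The infinite path: the \<open>n\<^sup>m\<close> subtrees at level \<open>m\<close> are independent, so in the supercritical case some
subtree survives almost surely even without help from above. Conversely, an infinite covered path
makes the subtree of its first vertex survive with some inherited cover \<open>c\<close>. Such a \<open>c\<close> is smaller
than some possible label \<open>y\<close>, and the tree of a root labelled \<open>y\<close> survives at least as well; so if the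
process dies out almost surely, there is almost surely no infinite path.

Uncovered vertices: declare a vertex \<open>h\<close> levels above level \<open>L\<close> open if its label is at most \<open>h\<close>.
A vertex of level \<open>L\<close> is uncovered iff its ancestral path is open, and the probability of an open
path tends to \<open>1\<close> as \<open>L \<rightarrow> \<infinity>\<close>, because \<open>P(Y \<le> h) \<rightarrow> 1\<close> and \<open>n \<ge> 2\<close> (\<open>open_path_prob_tendsto_1\<close>).\<close>

section \<open>Words, covered vertices and types\<close>

lemma Nil_in_verts [simp]: "[] \<in> verts n"
  by (simp add: verts_def)

lemma Cons_in_verts [simp]: "j # w \<in> verts n \<longleftrightarrow> j \<in> {1..n} \<and> w \<in> verts n"
  by (auto simp: verts_def)

lemma append_in_verts [simp]: "u @ w \<in> verts n \<longleftrightarrow> u \<in> verts n \<and> w \<in> verts n"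
  by (auto simp: verts_def)

lemma take_in_verts: "w \<in> verts n \<Longrightarrow> take i w \<in> verts n"
  by (auto simp: verts_def dest: in_set_takeD)

lemma finite_level: "finite {w \<in> verts n. length w = k}"
proof -
  have "{w \<in> verts n. length w = k} = {w. set w \<subseteq> {1..n} \<and> length w = k}"
    by (auto simp: verts_def)
  then show ?thesis using finite_lists_length_eq[of "{1..n}" k] by simp
qed

lemma finite_levels_below: "finite {w \<in> verts n. length w < k}"
proof -
  have "{w \<in> verts n. length w < k} = (\<Union>i<k. {w \<in> verts n. length w = i})" by auto
  then show ?thesis using finite_level by simp
qed

lemma edges_relpow_iff:
  assumes "x \<in> verts n"
  shows "(x, y) \<in> edges n ^^ m \<longleftrightarrow> (\<exists>w\<in>verts n. length w = m \<and> y = x @ w)"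
proof (induction m arbitrary: y)
  case 0
  then show ?case by auto
next
  case (Suc m)
  show ?case
  proof
    assume "(x, y) \<in> edges n ^^ Suc m"
    then obtain z where "(x, z) \<in> edges n ^^ m" and z: "(z, y) \<in> edges n" by auto
    then obtain w where w: "w \<in> verts n" "length w = m" "z = x @ w" using Suc.IH by blast
    from z obtain j where "j \<in> {1..n}" "y = z @ [j]" by (auto simp: edges_def)
    then have "w @ [j] \<in> verts n \<and> length (w @ [j]) = Suc m \<and> y = x @ (w @ [j])"
      using w by simp
    then show "\<exists>w\<in>verts n. length w = Suc m \<and> y = x @ w" by blast
  next
    assume "\<exists>w\<in>verts n. length w = Suc m \<and> y = x @ w"
    then obtain w where w: "w \<in> verts n" "length w = Suc m" "y = x @ w" by blast
    then obtain w' j where w': "w = w' @ [j]" by (cases w rule: rev_cases) auto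
    have "(x, x @ w') \<in> edges n ^^ m" using Suc.IH w w' by auto
    moreover have "(x @ w', y) \<in> edges n"
      using w w' assms by (auto simp: edges_def)
    ultimately show "(x, y) \<in> edges n ^^ Suc m" by auto
  qed
qed

lemma edges_rtrancl_iff:
  assumes "x \<in> verts n"
  shows "(x, y) \<in> (edges n)\<^sup>* \<longleftrightarrow> (\<exists>w\<in>verts n. y = x @ w)"
  using edges_relpow_iff[OF assms] by (auto simp: rtrancl_is_UN_relpow)

lemma tree_dist_append:
  assumes "x \<in> verts n" "w \<in> verts n"
  shows "tree_dist n x (x @ w) = enat (length w)"
proof -
  have "{m. (x, x @ w) \<in> edges n ^^ m} = {length w}"
    using edges_relpow_iff[OF assms(1)] assms(2) by auto
  then show ?thesis by (simp add: tree_dist_def)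
qed

lemma tree_dist_finite_iff:
  assumes "x \<in> verts n"
  shows "tree_dist n x y < \<infinity> \<longleftrightarrow> (\<exists>w\<in>verts n. y = x @ w)"
proof
  assume *: "tree_dist n x y < \<infinity>"
  have "{m. (x, y) \<in> edges n ^^ m} \<noteq> {}"
  proof
    assume "{m. (x, y) \<in> edges n ^^ m} = {}"
    then have "tree_dist n x y = Inf ({} :: enat set)" unfolding tree_dist_def by simp
    with * show False by (simp add: top_enat_def)
  qed
  then show "\<exists>w\<in>verts n. y = x @ w" using edges_relpow_iff[OF assms] by auto
next
  assume "\<exists>w\<in>verts n. y = x @ w"
  then show "tree_dist n x y < \<infinity>" using tree_dist_append[OF assms] by auto
qed

text \<open>Directed distances only occur between a vertex and its prefixes, so every quantifier over ancestors
in the definitions can be traded for one over prefix lengths.\<close>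

lemma ancestor_iff_take:
  assumes "v \<in> verts n"
  shows "(\<exists>w\<in>verts n. v = x @ w \<and> x \<in> verts n \<and> P x (length w)) \<longleftrightarrow>
         (\<exists>i\<le>length v. x = take i v \<and> P x (length v - i))"
proof
  assume "\<exists>w\<in>verts n. v = x @ w \<and> x \<in> verts n \<and> P x (length w)"
  then show "\<exists>i\<le>length v. x = take i v \<and> P x (length v - i)"
    by (intro exI[of _ "length x"]) auto
next
  assume "\<exists>i\<le>length v. x = take i v \<and> P x (length v - i)"
  then obtain i where "i \<le> length v" "x = take i v" "P x (length v - i)" by blast
  moreover have "v = take i v @ drop i v" by simp
  ultimately show "\<exists>w\<in>verts n. v = x @ w \<and> x \<in> verts n \<and> P x (length w)"
    using assms by (metis append_in_verts length_drop)
qed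

lemma covered_iff:
  "v \<in> covered n Y \<longleftrightarrow> v \<in> verts n \<and> (\<exists>i\<le>length v. length v - i < Y (take i v))"
proof -
  have "v \<in> covered n Y \<longleftrightarrow> v \<in> verts n \<and> (\<exists>x\<in>verts n. tree_dist n x v < enat (Y x))"
    by (auto simp: covered_def tree_ball_def)
  also have "\<dots> \<longleftrightarrow> v \<in> verts n \<and>
      (\<exists>x. \<exists>w\<in>verts n. v = x @ w \<and> x \<in> verts n \<and> length w < Y x)"
  proof -
    have "tree_dist n x v < enat (Y x) \<longleftrightarrow> (\<exists>w\<in>verts n. v = x @ w \<and> length w < Y x)"
      if x: "x \<in> verts n" for x
    proof
      assume *: "tree_dist n x v < enat (Y x)"
      also have "enat (Y x) < \<infinity>" by simp
      finally obtain w where "w \<in> verts n" "v = x @ w"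
        using tree_dist_finite_iff[OF x, of v] by blast
      then show "\<exists>w\<in>verts n. v = x @ w \<and> length w < Y x"
        using * tree_dist_append[OF x, of w] by auto
    next
      assume "\<exists>w\<in>verts n. v = x @ w \<and> length w < Y x"
      then show "tree_dist n x v < enat (Y x)" using tree_dist_append[OF x] by auto
    qed
    then show ?thesis by blast
  qed
  also have "\<dots> \<longleftrightarrow> v \<in> verts n \<and> (\<exists>i\<le>length v. length v - i < Y (take i v))"
  proof (cases "v \<in> verts n")
    case True
    show ?thesis unfolding ancestor_iff_take[OF True, of _ "\<lambda>x l. l < Y x"] by blast
  qed simp
  finally show ?thesis .
qed

lemma individuals_iff:
  "y \<in> individuals n Y k \<longleftrightarrow>
     y \<in> verts n \<and> length y = k \<and> (\<forall>i\<le>k. take i y \<in> covered n Y)"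
proof -
  have *: "([], v) \<in> (edges n)\<^sup>* \<and> (v, y) \<in> (edges n)\<^sup>* \<longleftrightarrow> (\<exists>i\<le>length y. v = take i y)"
    if "y \<in> verts n" for v
    using ancestor_iff_take[OF that, of v "\<lambda>_ _. True"] edges_rtrancl_iff[of "[]" n v]
      edges_rtrancl_iff[of v n y] by auto
  then have "(\<forall>v. ([], v) \<in> (edges n)\<^sup>* \<and> (v, y) \<in> (edges n)\<^sup>* \<longrightarrow> v \<in> covered n Y) \<longleftrightarrow>
      (\<forall>i\<le>length y. take i y \<in> covered n Y)" if "y \<in> verts n"
    using that by metis
  then show ?thesis
    using tree_dist_append[of "[]" n y] by (auto simp: individuals_def)
qed

text \<open>The type of the descendant \<open>u @ w\<close> of \<open>u\<close>, when \<open>u\<close> inherits cover \<open>c\<close> from above and otherwise only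
labels from \<open>u\<close> on count. The subtraction truncates, so the value \<open>0\<close> means uncovered. Unlike the
maximum over all ancestors, this form consumes the tree from the root downwards, as the survival
recursion does.\<close>

fun load :: "(nat list \<Rightarrow> nat) \<Rightarrow> nat list \<Rightarrow> nat \<Rightarrow> nat list \<Rightarrow> nat" where
  "load Y u c [] = max c (Y u)"
| "load Y u c (j # w) = load Y (u @ [j]) (max c (Y u) - 1) w"

lemma load_append: "load Y u c (v @ j # w) = load Y (u @ v @ [j]) (load Y u c v - 1) w"
  by (induction v arbitrary: u c) auto

text \<open>The recursion computes the maximum of \<open>Y x - d(x, y)\<close> over the ancestors. The restriction to positive
thresholds is what makes the truncated subtraction harmless.\<close>

lemma le_load_iff:
  assumes "1 \<le> t"
  shows "t \<le> load Y u c w \<longleftrightarrow>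
    t + length w \<le> c \<or> (\<exists>i\<le>length w. t + (length w - i) \<le> Y (u @ take i w))"
proof (induction w arbitrary: u c)
  case Nil
  then show ?case by (auto simp: max_def)
next
  case (Cons j w)
  \<comment> \<open>The prefix of length \<open>0\<close> is the vertex \<open>u\<close> itself; the others pass through its child.\<close>
  have split: "(\<exists>i\<le>length (j # w). t + (length (j # w) - i) \<le> Y (u @ take i (j # w))) \<longleftrightarrow>
      t + Suc (length w) \<le> Y u \<or> (\<exists>i\<le>length w. t + (length w - i) \<le> Y ((u @ [j]) @ take i w))"
    (is "?L \<longleftrightarrow> ?R")
  proof
    assume ?L
    then obtain i where i: "i \<le> Suc (length w)"
      "t + (Suc (length w) - i) \<le> Y (u @ take i (j # w))" by auto
    then show ?R by (cases i) auto
  next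
    assume ?R
    then show ?L
    proof
      assume "t + Suc (length w) \<le> Y u"
      then show ?L by (intro exI[of _ 0]) simp
    next
      assume "\<exists>i\<le>length w. t + (length w - i) \<le> Y ((u @ [j]) @ take i w)"
      then obtain i where "i \<le> length w" "t + (length w - i) \<le> Y ((u @ [j]) @ take i w)" by blast
      then show ?L by (intro exI[of _ "Suc i"]) simp
    qed
  qed
  have "t + length w \<le> max c (Y u) - 1 \<longleftrightarrow> t + length (j # w) \<le> c \<or> t + Suc (length w) \<le> Y u"
    using assms by (auto simp: max_def)
  then show ?case unfolding split load.simps Cons.IH by blast
qed

lemma covered_iff_load: "v \<in> covered n Y \<longleftrightarrow> v \<in> verts n \<and> 1 \<le> load Y [] 0 v"
  using le_load_iff[of 1 Y "[]" 0 v] by (auto simp: covered_iff Suc_le_eq)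

lemma individuals_iff_load:
  "y \<in> individuals n Y k \<longleftrightarrow> y \<in> verts n \<and> length y = k \<and> (\<forall>i\<le>k. 1 \<le> load Y [] 0 (take i y))"
  by (auto simp: individuals_iff covered_iff_load take_in_verts)

lemma ind_type_eq_load:
  assumes "y \<in> verts n" "1 \<le> load Y [] 0 y"
  shows "ind_type n Y y = int (load Y [] 0 y)"
proof -
  let ?f = "\<lambda>i. int (Y (take i y)) - int (length y - i)"
  let ?A = "?f ` {..length y}"
  have "{int (Y x) - int (the_enat (tree_dist n x y)) | x. x \<in> verts n \<and> tree_dist n x y < \<infinity>} = ?A"
    (is "?B = _")
  proof -
    have "a \<in> ?B \<longleftrightarrow> a \<in> ?A" for a
    proof -
      have "a \<in> ?B \<longleftrightarrow>
          (\<exists>x. \<exists>w\<in>verts n. y = x @ w \<and> x \<in> verts n \<and> a = int (Y x) - int (length w))"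
        (is "_ = ?R")
      proof
        assume "a \<in> ?B"
        then obtain x where x: "x \<in> verts n" "tree_dist n x y < \<infinity>"
          "a = int (Y x) - int (the_enat (tree_dist n x y))" by blast
        then obtain w where "w \<in> verts n" "y = x @ w" using tree_dist_finite_iff by blast
        then show ?R using x tree_dist_append[of x n w] by auto
      next
        assume ?R
        then obtain x w where x: "w \<in> verts n" "y = x @ w" "x \<in> verts n"
          "a = int (Y x) - int (length w)" by blast
        then have "tree_dist n x y = enat (length w)" using tree_dist_append[of x n w] by simp
        then show "a \<in> ?B" using x by (intro CollectI exI[of _ x]) simp
      qed
      also have "\<dots> \<longleftrightarrow> (\<exists>x. \<exists>i\<le>length y. x = take i y \<and> a = int (Y x) - int (length y - i))"
        using ancestor_iff_take[OF assms(1), of _ "\<lambda>x l. a = int (Y x) - int l"] by simp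
      also have "\<dots> \<longleftrightarrow> a \<in> ?A" by blast
      finally show ?thesis .
    qed
    then show ?thesis by blast
  qed
  then have eq: "ind_type n Y y = Max ?A" by (simp add: ind_type_def)
  let ?t = "load Y [] 0 y"
  have "int ?t \<le> Max ?A"
  proof -
    obtain i where "i \<le> length y" "?t + (length y - i) \<le> Y (take i y)"
      using le_load_iff[OF assms(2), of Y "[]" 0 y] assms(2) by auto
    then have "int ?t \<le> ?f i" by linarith
    then show ?thesis using Max_ge[of ?A "?f i"] \<open>i \<le> length y\<close> by (simp add: order_trans)
  qed
  moreover have "Max ?A \<le> int ?t"
  proof (rule Max.boundedI)
    fix a assume "a \<in> ?A"
    then obtain i where i: "i \<le> length y" "a = ?f i" by auto
    show "a \<le> int ?t"
    proof (cases "a \<le> 1")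
      case False
      then have "nat a \<le> ?t"
        using i le_load_iff[of "nat a" Y "[]" 0 y] by (auto simp: nat_le_iff)
      then show ?thesis by linarith
    qed (use assms(2) in linarith)
  qed auto
  ultimately have "int ?t = Max ?A" by (rule antisym)
  then show ?thesis using eq by (simp only:)
qed

section \<open>The transfer operator of a ray\<close>

text \<open>Expectations over labels are used as integrals in the analysis, but they arise from summing over
the value of one label.\<close>

lemma measure_pmf_expectation_nat_sums:
  fixes p :: "nat pmf" and f :: "nat \<Rightarrow> real"
  assumes "\<And>y. \<bar>f y\<bar> \<le> B"
  shows "(\<lambda>y. pmf p y * f y) sums measure_pmf.expectation p f"
proof -
  have int: "integrable (measure_pmf p) f"
    using assms by (intro measure_pmf.integrable_const_bound[where B=B]) auto
  then have "integrable (count_space UNIV) (\<lambda>y. pmf p y * f y)"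
    by (simp add: measure_pmf_eq_density integrable_density)
  from sums_integral_count_space_nat[OF this] show ?thesis
    by (simp add: measure_pmf_eq_density integral_density)
qed

text \<open>One step down a ray: a vertex that inherits cover \<open>c\<close> gets label \<open>y\<close>, has type \<open>max c y\<close> and hands
\<open>max c y - 1\<close> on. The labels outside \<open>S\<close> are forbidden; \<open>S = UNIV\<close> is the original model and
\<open>S = {..N}\<close> the truncated one, whose types are bounded.\<close>

definition transfer :: "nat pmf \<Rightarrow> nat set \<Rightarrow> (nat \<Rightarrow> real) \<Rightarrow> nat \<Rightarrow> real" where
  "transfer \<mu> S h c =
     measure_pmf.expectation \<mu> (\<lambda>y. if y \<in> S \<and> 1 \<le> max c y then h (max c y - 1) else 0)"

lemma integrable_transfer:
  assumes "bounded (range h)"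
  shows "integrable (measure_pmf \<mu>) (\<lambda>y. if y \<in> S \<and> 1 \<le> max c y then h (max c y - 1) else (0::real))"
proof -
  obtain B where B: "\<And>c. \<bar>h c\<bar> \<le> B" using assms by (auto simp: bounded_iff)
  have "\<bar>h c\<bar> \<le> \<bar>B\<bar>" for c using B[of c] by linarith
  then show ?thesis
    by (intro measure_pmf.integrable_const_bound[where B="\<bar>B\<bar>"]) auto
qed

lemma transfer_mono:
  assumes "bounded (range f)" "bounded (range g)" "\<And>c. f c \<le> g c"
  shows "transfer \<mu> S f c \<le> transfer \<mu> S g c"
  unfolding transfer_def
  by (intro integral_mono integrable_transfer) (auto simp: assms)

lemma transfer_add:
  assumes "bounded (range f)" "bounded (range g)"
  shows "transfer \<mu> S (\<lambda>c. f c + g c) c = transfer \<mu> S f c + transfer \<mu> S g c"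
proof -
  have "transfer \<mu> S (\<lambda>c. f c + g c) c =
     measure_pmf.expectation \<mu> (\<lambda>y. (if y \<in> S \<and> 1 \<le> max c y then f (max c y - 1) else 0) +
        (if y \<in> S \<and> 1 \<le> max c y then g (max c y - 1) else 0))"
    unfolding transfer_def by (rule arg_cong[where f="measure_pmf.expectation \<mu>"]) auto
  also have "\<dots> = transfer \<mu> S f c + transfer \<mu> S g c"
    unfolding transfer_def
    by (intro Bochner_Integration.integral_add integrable_transfer assms)
  finally show ?thesis .
qed

lemma transfer_cmult: "transfer \<mu> S (\<lambda>c. a * f c) c = a * transfer \<mu> S f c"
proof -
  have "transfer \<mu> S (\<lambda>c. a * f c) c =
     measure_pmf.expectation \<mu> (\<lambda>y. a * (if y \<in> S \<and> 1 \<le> max c y then f (max c y - 1) else 0))"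
    unfolding transfer_def by (rule arg_cong[where f="measure_pmf.expectation \<mu>"]) auto
  then show ?thesis by (simp add: transfer_def)
qed

lemma transfer_nonneg: "(\<And>c. 0 \<le> h c) \<Longrightarrow> 0 \<le> transfer \<mu> S h c"
  unfolding transfer_def by (intro Bochner_Integration.integral_nonneg) auto

lemma transfer_le:
  assumes "\<And>c. 0 \<le> h c" "\<And>c. h c \<le> B"
  shows "transfer \<mu> S h c \<le> B"
proof -
  have B: "0 \<le> B" using order_trans[OF assms(1)[of 0] assms(2)[of 0]] .
  have "bounded (range h)" using assms by (auto simp: bounded_iff intro!: exI[of _ B])
  then show ?thesis
    unfolding transfer_def using assms B
    by (intro measure_pmf.integral_le_const integrable_transfer) auto
qed

lemma bounded_range_unit: "(\<And>c. 0 \<le> h c) \<Longrightarrow> (\<And>c. h c \<le> B) \<Longrightarrow> bounded (range (h :: nat \<Rightarrow> real))"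
  by (auto simp: bounded_iff intro!: exI[of _ B])

lemma bounded_range_sum:
  fixes f :: "nat \<Rightarrow> nat \<Rightarrow> real"
  assumes "\<And>k. bounded (range (f k))"
  shows "bounded (range (\<lambda>c. \<Sum>k<m. f k c))"
  by (induction m) (auto intro!: bounded_plus_comp assms)

lemma bounded_range_cmult:
  "bounded (range f) \<Longrightarrow> bounded (range (\<lambda>c. a * f c :: real))"
  using bounded_scaleR_comp[of f UNIV a] by simp

lemma transfer_sum:
  fixes f :: "nat \<Rightarrow> nat \<Rightarrow> real"
  assumes "\<And>k. bounded (range (f k))"
  shows "transfer \<mu> S (\<lambda>c. \<Sum>k<m. f k c) c = (\<Sum>k<m. transfer \<mu> S (f k) c)"
proof (induction m)
  case 0
  then show ?case by (simp add: transfer_def cong: if_cong)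
next
  case (Suc m)
  then show ?case by (simp add: transfer_add bounded_range_sum assms)
qed

lemma transfer_mono_arg:
  assumes "bounded (range h)" "mono h" "\<And>c. 0 \<le> h c"
  shows "mono (transfer \<mu> S h)"
proof (rule monoI)
  fix c d :: nat assume cd: "c \<le> d"
  show "transfer \<mu> S h c \<le> transfer \<mu> S h d"
    unfolding transfer_def
  proof (intro integral_mono integrable_transfer assms(1))
    fix y
    have "max c y - 1 \<le> max d y - 1" using cd by (auto simp: max_def)
    then show "(if y \<in> S \<and> 1 \<le> max c y then h (max c y - 1) else 0) \<le>
               (if y \<in> S \<and> 1 \<le> max d y then h (max d y - 1) else 0)"
      using cd assms(3) monoD[OF assms(2)] by (auto simp: le_max_iff_disj)
  qed
qed

text \<open>The probability that the first \<open>m\<close> vertices of a ray are covered and carry labels from \<open>S\<close>, given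
the cover inherited by the first one.\<close>

primrec cover_mass :: "nat pmf \<Rightarrow> nat set \<Rightarrow> nat \<Rightarrow> nat \<Rightarrow> real" where
  "cover_mass \<mu> S 0 = (\<lambda>c. 1)"
| "cover_mass \<mu> S (Suc m) = transfer \<mu> S (cover_mass \<mu> S m)"

text \<open>The probability that a subtree whose root inherits a given cover reaches depth \<open>k\<close>. Depth \<open>0\<close>
demands that the root itself be covered.\<close>

primrec survival :: "nat pmf \<Rightarrow> nat set \<Rightarrow> nat \<Rightarrow> nat \<Rightarrow> nat \<Rightarrow> real" where
  "survival \<mu> S n 0 = transfer \<mu> S (\<lambda>c. 1)"
| "survival \<mu> S n (Suc k) = transfer \<mu> S (\<lambda>c. 1 - (1 - survival \<mu> S n k c) ^ n)"

lemma cover_mass_bounds: "0 \<le> cover_mass \<mu> S m c" "cover_mass \<mu> S m c \<le> 1"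
proof -
  have "(\<forall>c. 0 \<le> cover_mass \<mu> S m c \<and> cover_mass \<mu> S m c \<le> 1)"
    by (induction m) (auto intro: transfer_nonneg transfer_le)
  then show "0 \<le> cover_mass \<mu> S m c" "cover_mass \<mu> S m c \<le> 1" by auto
qed

lemma bounded_cover_mass: "bounded (range (cover_mass \<mu> S m))"
  by (rule bounded_range_unit[of _ 1]) (simp_all add: cover_mass_bounds)

lemma mono_cover_mass: "mono (cover_mass \<mu> S m)"
proof (induction m)
  case (Suc m)
  show ?case using transfer_mono_arg[OF bounded_cover_mass Suc.IH cover_mass_bounds(1)] by simp
qed (simp add: mono_def)

lemma offspring_bounds:
  fixes t :: real
  assumes "0 \<le> t" "t \<le> 1"
  shows "0 \<le> 1 - (1 - t) ^ n" "1 - (1 - t) ^ n \<le> 1"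
  using assms by (auto intro!: power_le_one)

lemma survival_bounds: "0 \<le> survival \<mu> S n k c" "survival \<mu> S n k c \<le> 1"
proof -
  have "(\<forall>c. 0 \<le> survival \<mu> S n k c \<and> survival \<mu> S n k c \<le> 1)"
  proof (induction k)
    case (Suc k)
    then show ?case
      using offspring_bounds[of "survival \<mu> S n k _" n] by (auto intro!: transfer_nonneg transfer_le)
  qed (auto intro: transfer_nonneg transfer_le)
  then show "0 \<le> survival \<mu> S n k c" "survival \<mu> S n k c \<le> 1" by auto
qed

lemma bounded_survival: "bounded (range (survival \<mu> S n k))"
  by (rule bounded_range_unit[of _ 1]) (simp_all add: survival_bounds)

lemma bounded_offspring_survival: "bounded (range (\<lambda>c. 1 - (1 - survival \<mu> S n k c) ^ n))"
  by (rule bounded_range_unit[of _ 1]) (simp_all only: offspring_bounds survival_bounds)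

lemma mono_survival: "mono (survival \<mu> S n k)"
proof (induction k)
  case 0
  have "mono (transfer \<mu> S (\<lambda>c. 1))"
    by (rule transfer_mono_arg) (auto simp: mono_def)
  then show ?case by simp
next
  case (Suc k)
  have "mono (\<lambda>c. 1 - (1 - survival \<mu> S n k c) ^ n)"
    using monoD[OF Suc.IH] survival_bounds by (auto intro!: monoI power_mono)
  then show ?case
    by (auto intro!: transfer_mono_arg bounded_offspring_survival offspring_bounds survival_bounds)
qed

section \<open>The renewal equation\<close>

text \<open>The probability that \<open>m\<close> labels, at distances \<open>0, \<dots>, m - 1\<close> above a vertex, lie in
\<open>S\<close> and all fail to cover it.\<close>

definition uncover_mass :: "nat pmf \<Rightarrow> nat set \<Rightarrow> nat \<Rightarrow> real" where
  "uncover_mass \<mu> S m = (\<Prod>i<m. measure_pmf.prob \<mu> ({..i} \<inter> S))"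

text \<open>The probability that the nearest ancestor covering a vertex is \<open>k\<close> steps above it, and that
the labels up to that ancestor lie in \<open>S\<close>.\<close>

definition nearest_mass :: "nat pmf \<Rightarrow> nat set \<Rightarrow> nat \<Rightarrow> real" where
  "nearest_mass \<mu> S k = uncover_mass \<mu> S k * measure_pmf.prob \<mu> ({k<..} \<inter> S)"

lemma nearest_mass_nonneg: "0 \<le> nearest_mass \<mu> S k"
  by (simp add: nearest_mass_def uncover_mass_def prod_nonneg)

lemma transfer_threshold:
  "transfer \<mu> S (\<lambda>d. if m \<le> d then 1 else 0) c =
     (if Suc m \<le> c then measure_pmf.prob \<mu> S else measure_pmf.prob \<mu> ({m<..} \<inter> S))"
proof -
  have "transfer \<mu> S (\<lambda>d. if m \<le> d then 1 else 0) c =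
      measure_pmf.expectation \<mu> (indicator (if Suc m \<le> c then S else {m<..} \<inter> S))"
    unfolding transfer_def
    by (rule arg_cong[where f="measure_pmf.expectation \<mu>"])
       (auto simp: indicator_def fun_eq_iff max_def)
  then show ?thesis by simp
qed

text \<open>Decomposition according to the nearest label that covers the last vertex, at distance \<open>k\<close> from it;
the second summand is the case in which only the inherited cover reaches that far. Everything
above the covering vertex is unconditioned. The proof applies \<^const>\<open>transfer\<close> to both sides: it
shifts each renewal term by one step, and the boundary term splits off the case \<open>k = m\<close>.\<close>

lemma cover_mass_renewal:
  "cover_mass \<mu> S m c = (\<Sum>k<m. nearest_mass \<mu> S k * cover_mass \<mu> S (m - 1 - k) c) + (if m \<le> c then uncover_mass \<mu> S m else 0)"
proof (induction m arbitrary: c)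
  case 0
  show ?case by (simp add: uncover_mass_def)
next
  case (Suc m)
  let ?W = "cover_mass \<mu> S" and ?g = "nearest_mass \<mu> S" and ?u = "uncover_mass \<mu> S"
  have eq: "?W m = (\<lambda>c. (\<Sum>k<m. ?g k * ?W (m - 1 - k) c) + ?u m * (if m \<le> c then 1 else 0))"
    by (rule ext, subst Suc.IH) simp
  have bd: "bounded (range (\<lambda>c. ?g k * ?W (m - 1 - k) c))" for k
    by (intro bounded_range_cmult bounded_cover_mass)
  have bd': "bounded (range (\<lambda>c. ?u m * (if m \<le> c then 1 else 0)))"
    by (rule bounded_range_cmult, rule bounded_range_unit[of _ 1]) auto
  have "?W (Suc m) c = transfer \<mu> S (\<lambda>c. (\<Sum>k<m. ?g k * ?W (m - 1 - k) c) +
      ?u m * (if m \<le> c then 1 else 0)) c"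
    by (subst eq[symmetric]) simp
  also have "\<dots> = (\<Sum>k<m. ?g k * transfer \<mu> S (?W (m - 1 - k)) c) +
      ?u m * transfer \<mu> S (\<lambda>c. if m \<le> c then 1 else 0) c"
    by (subst transfer_add[OF bounded_range_sum[OF bd] bd'], subst transfer_sum[OF bd])
       (simp only: transfer_cmult)
  also have "(\<Sum>k<m. ?g k * transfer \<mu> S (?W (m - 1 - k)) c) = (\<Sum>k<m. ?g k * ?W (m - k) c)"
  proof (rule sum.cong)
    fix k assume "k \<in> {..<m}"
    then have "m - k = Suc (m - 1 - k)" by simp
    then show "?g k * transfer \<mu> S (?W (m - 1 - k)) c = ?g k * ?W (m - k) c"
      by (simp only: cover_mass.simps)
  qed simp
  also have "?u m * transfer \<mu> S (\<lambda>c. if m \<le> c then 1 else 0) c =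
      ?g m + (if Suc m \<le> c then ?u (Suc m) else 0)"
  proof -
    have "measure_pmf.prob \<mu> S =
        measure_pmf.prob \<mu> (({m<..} \<inter> S) \<union> ({..m} \<inter> S))"
      by (rule arg_cong[where f="measure_pmf.prob \<mu>"]) auto
    also have "\<dots> = measure_pmf.prob \<mu> ({m<..} \<inter> S) + measure_pmf.prob \<mu> ({..m} \<inter> S)"
      by (rule measure_pmf.finite_measure_Union) auto
    finally show ?thesis
      by (simp add: transfer_threshold nearest_mass_def uncover_mass_def algebra_simps)
  qed
  finally show ?case by simp
qed

section \<open>Extinction and survival of the recursion\<close>

text \<open>The loss \<open>t\<^sup>2\<close> against linear reproduction comes from two children surviving simultaneously; with a
single child, \<open>1 - (1 - t)\<^sup>n\<close> is equal to \<open>n t\<close>.\<close>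

lemma offspring_le_linear_minus_square:
  fixes t :: real
  assumes "0 \<le> t" "t \<le> 1" "2 \<le> n"
  shows "1 - (1 - t) ^ n + t\<^sup>2 \<le> real n * t"
  using assms(3)
proof (induction n rule: dec_induct)
  case base
  show ?case by (simp add: power2_eq_square algebra_simps)
next
  case (step n)
  have "(1 - t) ^ Suc n \<ge> (1 - t) * (1 - real n * t + t\<^sup>2)"
    using assms step.IH by (auto intro!: mult_left_mono)
  moreover have "(1 - t) * (1 - real n * t + t\<^sup>2) =
      1 - real (Suc n) * t + t\<^sup>2 + t\<^sup>2 * (real n - t)"
    by (simp add: algebra_simps power2_eq_square)
  moreover have "0 \<le> t\<^sup>2 * (real n - t)" using assms step.hyps by simp
  ultimately show ?case by linarith
qed

lemma offspring_ge_linear_minus_square: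
  fixes t :: real
  assumes "0 \<le> t" "t \<le> 1"
  shows "real n * t * (1 - real n * t) \<le> 1 - (1 - t) ^ n"
proof -
  have "(1 - t) ^ n \<le> 1 - real n * t + (real n)\<^sup>2 * t\<^sup>2"
  proof (induction n)
    case (Suc n)
    have "(1 - t) ^ Suc n \<le> (1 - t) * (1 - real n * t + (real n)\<^sup>2 * t\<^sup>2)"
      using assms Suc.IH by (auto intro!: mult_left_mono)
    also have "\<dots> = 1 - real (Suc n) * t + (real (Suc n))\<^sup>2 * t\<^sup>2
        - (real n * t\<^sup>2 + t\<^sup>2 + (real n)\<^sup>2 * t\<^sup>2 * t)"
      by (simp add: algebra_simps power2_eq_square)
    also have "\<dots> \<le> 1 - real (Suc n) * t + (real (Suc n))\<^sup>2 * t\<^sup>2"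
    proof -
      have "0 \<le> real n * t\<^sup>2 + t\<^sup>2 + (real n)\<^sup>2 * t\<^sup>2 * t"
        using assms by (intro add_nonneg_nonneg mult_nonneg_nonneg) auto
      then show ?thesis by linarith
    qed
    finally show ?case .
  qed simp
  then show ?thesis by (simp add: algebra_simps power2_eq_square)
qed

text \<open>Partial sums express that the possibly divergent series \<open>\<Sum>k. g\<^sub>k n\<^bsup>k+1\<^esup>\<close> exceeds \<open>1\<close>, and they hand
out the finite set of terms on which the truncation relies.\<close>

definition supercritical :: "nat pmf \<Rightarrow> nat set \<Rightarrow> nat \<Rightarrow> bool" where
  "supercritical \<mu> S n \<longleftrightarrow> (\<exists>K. 1 < (\<Sum>k<K. nearest_mass \<mu> S k * real n ^ Suc k))"

text \<open>A renewal sequence whose steps have total mass at most \<open>1\<close> cannot exceed its initial value.\<close>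

lemma cover_mass_le_if_not_supercritical:
  assumes "\<not> supercritical \<mu> S n"
  shows "real n ^ m * cover_mass \<mu> S m 0 \<le> 1"
proof (induction m rule: less_induct)
  case (less m)
  show ?case
  proof (cases m)
    case (Suc l)
    have "real n ^ m * cover_mass \<mu> S m 0 =
        (\<Sum>k<m. nearest_mass \<mu> S k * real n ^ Suc k * (real n ^ (m - 1 - k) * cover_mass \<mu> S (m - 1 - k) 0))"
    proof -
      have "real n ^ m = real n ^ Suc k * real n ^ (m - 1 - k)" if "k < m" for k
        using that by (simp only: power_add[symmetric]) simp
      then show ?thesis
        by (subst cover_mass_renewal) (auto simp: Suc sum_distrib_left algebra_simps intro!: sum.cong)
    qed
    also have "\<dots> \<le> (\<Sum>k<m. nearest_mass \<mu> S k * real n ^ Suc k * 1)"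
      using less.IH by (intro sum_mono mult_left_mono) (auto simp: nearest_mass_nonneg)
    also have "\<dots> \<le> 1" using assms by (simp add: supercritical_def not_less)
    finally show ?thesis .
  qed simp
qed

text \<open>Suppose the survival probabilities are at least \<open>\<sigma>\<close>. By monotonicity in the inherited cover, each
step of the survival recursion falls short of the linear recursion by at least \<open>\<sigma>\<^sup>2\<close> on every
individual. Iterating the linear recursion, the expected size \<open>n\<^sup>m w\<^sub>m\<close> dominates the
survival probability plus \<open>\<sigma>\<^sup>2 / n\<close> times the sum of the expected sizes \<open>n\<^sup>i w\<^sub>i\<close> for \<open>i = 1, \<dots>, m\<close>.
Each of these is at least \<open>\<sigma>\<close>, so the bound \<open>1\<close> is violated eventually.\<close>

lemma survival_le_if_not_supercritical:
  assumes n: "2 \<le> n" and crit: "\<not> supercritical \<mu> S n" and "0 < \<sigma>"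
  shows "\<exists>k. survival \<mu> S n k 0 < \<sigma>"
proof (rule ccontr)
  assume "\<not> ?thesis"
  then have \<sigma>: "\<sigma> \<le> survival \<mu> S n k 0" for k by (auto simp: not_less)
  let ?W = "cover_mass \<mu> S" and ?s = "survival \<mu> S n"
  define T where "T m c = (\<Sum>i<m. real n ^ i * ?W (Suc i) c)" for m c
  have bdT: "bounded (range (T m))" for m
    unfolding T_def by (intro bounded_range_sum bounded_range_cmult bounded_cover_mass)
  have step: "?s (Suc k) c + \<sigma>\<^sup>2 * ?W 1 c \<le> real n * transfer \<mu> S (?s k) c" for k c
  proof -
    have "?s (Suc k) c + \<sigma>\<^sup>2 * ?W 1 c =
        transfer \<mu> S (\<lambda>d. (1 - (1 - ?s k d) ^ n) + \<sigma>\<^sup>2 * 1) c"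
      by (subst transfer_add) (simp_all only: bounded_offspring_survival transfer_cmult, auto)
    also have "\<dots> \<le> transfer \<mu> S (\<lambda>d. real n * ?s k d) c"
    proof (rule transfer_mono)
      fix d
      have "\<sigma>\<^sup>2 \<le> (?s k d)\<^sup>2"
        using \<sigma>[of k] monoD[OF mono_survival, of 0 d \<mu> S n k] \<open>0 < \<sigma>\<close> by (intro power_mono) auto
      then show "(1 - (1 - ?s k d) ^ n) + \<sigma>\<^sup>2 * 1 \<le> real n * ?s k d"
        using offspring_le_linear_minus_square[OF survival_bounds n, of \<mu> S n k d] by linarith
    qed (auto intro!: bounded_plus_comp bounded_offspring_survival bounded_range_cmult bounded_survival)
    finally show ?thesis by (simp add: transfer_cmult)
  qed
  have main: "?s m c + \<sigma>\<^sup>2 * T m c \<le> real n ^ m * ?W m c" for m c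
  proof (induction m arbitrary: c)
    case 0
    then show ?case using survival_bounds[of \<mu> S n 0 c] by (simp add: T_def)
  next
    case (Suc m)
    have T_Suc: "T (Suc m) c = ?W 1 c + real n * transfer \<mu> S (T m) c"
    proof -
      have "transfer \<mu> S (T m) c = (\<Sum>i<m. real n ^ i * ?W (Suc (Suc i)) c)"
        unfolding T_def
        by (subst transfer_sum) (auto simp: transfer_cmult intro!: bounded_range_cmult bounded_cover_mass[of _ _ "Suc _", simplified])
      then show ?thesis
        unfolding T_def by (subst sum.lessThan_Suc_shift) (simp add: sum_distrib_left algebra_simps)
    qed
    have "?s (Suc m) c + \<sigma>\<^sup>2 * T (Suc m) c \<le>
        real n * (transfer \<mu> S (?s m) c + \<sigma>\<^sup>2 * transfer \<mu> S (T m) c)"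
      unfolding T_Suc using step[of m c] by (simp add: algebra_simps)
    also have "transfer \<mu> S (?s m) c + \<sigma>\<^sup>2 * transfer \<mu> S (T m) c =
        transfer \<mu> S (\<lambda>c. ?s m c + \<sigma>\<^sup>2 * T m c) c"
      by (simp add: transfer_add bounded_survival bounded_range_cmult bdT transfer_cmult)
    also have "\<dots> \<le> transfer \<mu> S (\<lambda>c. real n ^ m * ?W m c) c"
      by (rule transfer_mono)
         (auto intro!: bounded_plus_comp bounded_survival bounded_range_cmult bdT bounded_cover_mass Suc.IH)
    finally show ?case by (simp add: transfer_cmult mult_left_mono)
  qed
  have T_nonneg: "0 \<le> T m c" for m c
    unfolding T_def by (intro sum_nonneg mult_nonneg_nonneg cover_mass_bounds) auto
  have B: "\<sigma> \<le> real n ^ m * ?W m 0" for m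
  proof -
    have "0 \<le> \<sigma>\<^sup>2 * T m 0" by (simp add: T_nonneg)
    then show ?thesis using main[of m 0] \<sigma>[of m] by linarith
  qed
  have T_ge: "real m * (\<sigma> / real n) \<le> T m 0" for m
  proof -
    have "\<sigma> / real n \<le> real n ^ i * ?W (Suc i) 0" for i
      using B[of "Suc i"] n by (simp add: field_simps)
    then have "(\<Sum>i<m. \<sigma> / real n) \<le> T m 0" unfolding T_def by (intro sum_mono) auto
    then show ?thesis by simp
  qed
  obtain m where m: "1 < real m * (\<sigma>\<^sup>2 * (\<sigma> / real n))"
  proof -
    have "0 < \<sigma>\<^sup>2 * (\<sigma> / real n)" using \<open>0 < \<sigma>\<close> n by simp
    then show ?thesis using reals_Archimedean3 that by blast
  qed
  also have "\<dots> \<le> \<sigma>\<^sup>2 * T m 0" using mult_left_mono[OF T_ge[of m], of "\<sigma>\<^sup>2"] by (simp add: algebra_simps)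
  also have "\<dots> \<le> real n ^ m * ?W m 0" using main[of m 0] survival_bounds[of \<mu> S n m 0] by linarith
  also have "\<dots> \<le> 1" by (rule cover_mass_le_if_not_supercritical[OF crit])
  finally show False by simp
qed
text \<open>By continuity the criterion still holds with some \<open>s < n\<close> in place of \<open>n\<close>. Then \<open>s\<^sup>m w\<^sub>m\<close> is
bounded below by a combination of its \<open>K\<close> predecessors whose nonnegative weights add up to more
than \<open>1\<close>, hence never drops below the minimum of its first values.\<close>

lemma supercritical_growth:
  assumes "supercritical \<mu> S n" "1 \<le> n"
  shows "\<exists>s c. 0 < s \<and> s < real n \<and> 0 < c \<and> (\<forall>m. c \<le> s ^ m * cover_mass \<mu> S m 0)"
proof -
  let ?g = "nearest_mass \<mu> S" and ?W = "\<lambda>m. cover_mass \<mu> S m 0"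
  obtain K where K: "1 < (\<Sum>k<K. ?g k * real n ^ Suc k)"
    using assms(1) by (auto simp: supercritical_def)
  \<comment> \<open>If \<open>g\<^sub>0\<close> vanished, no admissible label would be positive and all terms would vanish. Its positivity
    makes the initial values positive.\<close>
  have g0: "0 < ?g 0"
  proof (rule ccontr)
    assume "\<not> 0 < ?g 0"
    then have "measure_pmf.prob \<mu> ({0<..} \<inter> S) \<le> 0" by (simp add: nearest_mass_def uncover_mass_def not_less)
    moreover have "measure_pmf.prob \<mu> ({k<..} \<inter> S) \<le> measure_pmf.prob \<mu> ({0<..} \<inter> S)" for k
      by (intro measure_pmf.finite_measure_mono) auto
    ultimately have "measure_pmf.prob \<mu> ({k<..} \<inter> S) \<le> 0" for k by (meson order_trans)
    then have "?g k = 0" for k by (simp add: nearest_mass_def measure_le_0_iff)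
    then show False using K by simp
  qed
  have W_pos: "0 < ?W m" for m
  proof (induction m)
    case (Suc m)
    have "0 < ?g 0 * ?W m" using g0 Suc.IH by simp
    also have "?g 0 * ?W m \<le> (\<Sum>k<Suc m. ?g k * cover_mass \<mu> S (Suc m - 1 - k) 0)"
      using member_le_sum[of 0 "{..<Suc m}" "\<lambda>k. ?g k * cover_mass \<mu> S (Suc m - 1 - k) 0"]
      by (simp add: nearest_mass_nonneg cover_mass_bounds)
    also have "\<dots> = ?W (Suc m)" by (subst cover_mass_renewal[of \<mu> S "Suc m"]) simp
    finally show ?case .
  qed simp
  define f where "f s = (\<Sum>k<K. ?g k * s ^ Suc k)" for s :: real
  have "(f \<longlongrightarrow> f (real n)) (at_left (real n))"
    unfolding f_def by (intro tendsto_intros)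
  then have "eventually (\<lambda>s. 1 < f s) (at_left (real n))"
    by (rule order_tendstoD(1)) (use K in \<open>simp only: f_def\<close>)
  moreover have "eventually (\<lambda>s. s \<in> {0<..<real n}) (at_left (real n))"
    using assms(2) by (intro eventually_at_left_real) simp
  ultimately have "eventually (\<lambda>s. 1 < f s \<and> s \<in> {0<..<real n}) (at_left (real n))"
    by (rule eventually_conj)
  then obtain s where s: "1 < f s" "0 < s" "s < real n"
    using eventually_happens'[OF trivial_limit_at_left_real] by fastforce
  define b where "b m = s ^ m * ?W m" for m
  define c where "c = Min (b ` {..K})"
  have c_le: "c \<le> b m" if "m \<le> K" for m
    unfolding c_def using that by (intro Min_le) auto
  have c_pos: "0 < c"
    unfolding c_def b_def using s W_pos by (subst Min_gr_iff) auto
  have b_renewal: "b m \<ge> (\<Sum>k<m. ?g k * s ^ Suc k * b (m - 1 - k))" if "m \<ge> 1" for m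
  proof -
    have "s ^ m = s ^ Suc k * s ^ (m - 1 - k)" if "k < m" for k
      using that by (simp only: power_add[symmetric]) simp
    then have "(\<Sum>k<m. ?g k * s ^ Suc k * b (m - 1 - k)) =
        s ^ m * (\<Sum>k<m. ?g k * ?W (m - 1 - k))"
      by (auto simp: b_def sum_distrib_left algebra_simps intro!: sum.cong)
    also have "\<dots> \<le> b m"
      unfolding b_def using s cover_mass_renewal[of \<mu> S m 0] that by (intro mult_left_mono) auto
    finally show ?thesis .
  qed
  have "c \<le> b m" for m
  proof (induction m rule: less_induct)
    case (less m)
    show ?case
    proof (cases "m \<le> K")
      case False
      have "c \<le> f s * c" using s c_pos by simp
      also have "f s * c = (\<Sum>k<K. ?g k * s ^ Suc k * c)"
        by (simp add: f_def sum_distrib_right)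
      also have "\<dots> \<le> (\<Sum>k<m. ?g k * s ^ Suc k * c)"
        using False s c_pos by (intro sum_mono2) (auto simp: nearest_mass_nonneg)
      also have "\<dots> \<le> (\<Sum>k<m. ?g k * s ^ Suc k * b (m - 1 - k))"
        using less.IH s by (intro sum_mono mult_left_mono) (auto simp: nearest_mass_nonneg)
      also have "\<dots> \<le> b m" using False by (intro b_renewal) simp
      finally show ?thesis .
    qed (simp add: c_le)
  qed
  then show ?thesis using s c_pos unfolding b_def by blast
qed

text \<open>The function \<open>h = \<Sum>m<N. s\<^sup>m w\<^sub>m\<close> satisfies \<open>h \<le> s L h\<close> for the transfer operator \<open>L\<close>, because
\<open>s L h = h - 1 + s\<^sup>N w\<^sub>N\<close> and \<open>N\<close> is so large that \<open>s\<^sup>N w\<^sub>N \<ge> 1\<close>. As \<open>s < n\<close>, there is room to replace the linear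
reproduction \<open>n t\<close> by \<open>1 - (1 - t)\<^sup>n\<close> for small \<open>t\<close>; so \<open>\<epsilon> h\<close> is a subsolution of the survival
recursion for small \<open>\<epsilon>\<close> and bounds the survival probabilities from below at every depth.\<close>

lemma supercritical_survival:
  assumes "supercritical \<mu> S n" "1 \<le> n"
  shows "\<exists>\<epsilon>>0. \<forall>k. \<epsilon> \<le> survival \<mu> S n k 0"
proof -
  let ?W = "cover_mass \<mu> S" and ?L = "transfer \<mu> S"
  obtain s0 c where s0: "0 < s0" "s0 < real n" "0 < c" "\<And>m. c \<le> s0 ^ m * ?W m 0"
    using supercritical_growth[OF assms] by blast
  \<comment> \<open>With \<open>s0 < s\<close>, the masses \<open>s\<^sup>N w\<^sub>N\<close> are unbounded; with \<open>s < n\<close>, there is room for the nonlinearity.\<close>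
  define s where "s = (s0 + real n) / 2"
  have s: "s0 < s" "s < real n" "0 < s" using s0 by (auto simp: s_def)
  obtain N0 where N0: "1 / c < (s / s0) ^ N0"
    using real_arch_pow[of "s / s0" "1 / c"] s s0 by auto
  define N where "N = Suc N0"
  have "1 / c < (s / s0) ^ N"
    using N0 power_increasing[of N0 N "s / s0"] s s0 by (simp add: N_def)
  have sN: "1 \<le> s ^ N * ?W N d" for d
  proof -
    have "1 \<le> (s / s0) ^ N * c" using \<open>1 / c < (s / s0) ^ N\<close> s0 by (simp add: field_simps)
    also have "\<dots> \<le> (s / s0) ^ N * (s0 ^ N * ?W N 0)" using s s0 by (intro mult_left_mono) auto
    also have "\<dots> = s ^ N * ?W N 0" using s0 by (simp add: power_divide)
    also have "\<dots> \<le> s ^ N * ?W N d"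
      using s monoD[OF mono_cover_mass, of 0 d] by (intro mult_left_mono) auto
    finally show ?thesis .
  qed
  define h where "h d = (\<Sum>m<N. s ^ m * ?W m d)" for d
  define B where "B = (\<Sum>m<N. s ^ m)"
  have bd_h: "bounded (range h)"
    unfolding h_def by (intro bounded_range_sum bounded_range_cmult bounded_cover_mass)
  have h_ge: "1 \<le> h d" for d
  proof -
    have "s ^ 0 * ?W 0 d \<le> h d"
      unfolding h_def by (rule member_le_sum) (use s in \<open>auto simp: N_def cover_mass_bounds\<close>)
    then show ?thesis by simp
  qed
  have h_le: "h d \<le> B" for d
    unfolding h_def B_def using s cover_mass_bounds(2)[of \<mu> S _ d]
    by (intro sum_mono) (simp add: mult_left_le)
  have B: "1 \<le> B" using h_ge[of 0] h_le[of 0] by linarith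
  have Lh: "h d \<le> s * ?L h d" for d
  proof -
    have "s * ?L h d = (\<Sum>m<N. s ^ Suc m * ?W (Suc m) d)"
      unfolding h_def
      by (subst transfer_sum) (auto simp: transfer_cmult sum_distrib_left algebra_simps
          intro!: bounded_range_cmult bounded_cover_mass)
    also have "\<dots> = (\<Sum>m<N. s ^ m * ?W m d) - 1 + s ^ N * ?W N d"
      using sum.lessThan_Suc_shift[of "\<lambda>m. s ^ m * ?W m d" N] by simp
    finally show ?thesis using sN[of d] by (simp add: h_def)
  qed
  \<comment> \<open>The largest \<open>\<epsilon>\<close> with \<open>n (1 - n \<epsilon> h) \<ge> s\<close> for all values \<open>h \<le> B\<close>.\<close>
  define \<epsilon> where "\<epsilon> = (real n - s) / ((real n)\<^sup>2 * B)"
  have \<epsilon>: "0 < \<epsilon>" using s B assms(2) by (simp add: \<epsilon>_def)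
  have \<epsilon>B: "real n * (real n * (\<epsilon> * B)) = real n - s"
    using B assms(2) by (simp add: \<epsilon>_def power2_eq_square)
  have \<epsilon>B1: "\<epsilon> * B \<le> 1"
  proof -
    have "real n * (\<epsilon> * B) \<le> 1"
    proof (rule mult_left_le_imp_le)
      show "real n * (real n * (\<epsilon> * B)) \<le> real n * 1" using \<epsilon>B s by simp
    qed (use assms in simp)
    moreover have "\<epsilon> * B \<le> real n * (\<epsilon> * B)" using assms(2) \<epsilon> B by simp
    ultimately show ?thesis by linarith
  qed
  have unit: "0 \<le> \<epsilon> * h d" "\<epsilon> * h d \<le> 1" for d
  proof -
    show "0 \<le> \<epsilon> * h d" using \<epsilon> h_ge[of d] by simp
    have "\<epsilon> * h d \<le> \<epsilon> * B" using \<epsilon> h_le by (intro mult_left_mono) auto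
    then show "\<epsilon> * h d \<le> 1" using \<epsilon>B1 by linarith
  qed
  have bd_off: "bounded (range (\<lambda>d. 1 - (1 - \<epsilon> * h d) ^ n))"
    by (rule bounded_range_unit[of _ 1]) (simp_all only: offspring_bounds unit)
  have sub: "\<epsilon> * h d \<le> ?L (\<lambda>d. 1 - (1 - \<epsilon> * h d) ^ n) d" for d
  proof -
    have "\<epsilon> * h d \<le> \<epsilon> * (s * ?L h d)" using Lh \<epsilon> by (intro mult_left_mono) auto
    also have "\<dots> = ?L (\<lambda>d. \<epsilon> * s * h d) d" by (simp add: transfer_cmult)
    also have "\<dots> \<le> ?L (\<lambda>d. 1 - (1 - \<epsilon> * h d) ^ n) d"
    proof (rule transfer_mono[OF bounded_range_cmult[OF bd_h] bd_off])
      fix d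
      have "real n * (real n * (\<epsilon> * h d)) \<le> real n * (real n * (\<epsilon> * B))"
        using \<epsilon> h_le by (intro mult_left_mono) auto
      then have "s \<le> real n * (1 - real n * (\<epsilon> * h d))" using \<epsilon>B by (simp add: algebra_simps)
      then have "\<epsilon> * h d * s \<le> \<epsilon> * h d * (real n * (1 - real n * (\<epsilon> * h d)))"
        using unit by (intro mult_left_mono) auto
      also have "\<dots> \<le> 1 - (1 - \<epsilon> * h d) ^ n"
        using offspring_ge_linear_minus_square[OF unit, of n d] by (simp add: algebra_simps)
      finally show "\<epsilon> * s * h d \<le> 1 - (1 - \<epsilon> * h d) ^ n" by (simp add: algebra_simps)
    qed
    finally show ?thesis .
  qed
  have main: "\<epsilon> * h d \<le> survival \<mu> S n k d" for k d
  proof (induction k arbitrary: d)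
    case 0
    have "?L (\<lambda>d. 1 - (1 - \<epsilon> * h d) ^ n) d \<le> ?L (\<lambda>d. 1) d"
      using offspring_bounds[OF unit] by (intro transfer_mono bd_off) auto
    then show ?case using sub[of d] by simp
  next
    case (Suc k)
    have "?L (\<lambda>d. 1 - (1 - \<epsilon> * h d) ^ n) d \<le> ?L (\<lambda>d. 1 - (1 - survival \<mu> S n k d) ^ n) d"
      using Suc.IH survival_bounds
      by (intro transfer_mono bd_off bounded_offspring_survival) (auto intro!: power_mono)
    then show ?case using sub[of d] by simp
  qed
  have "\<epsilon> \<le> survival \<mu> S n k 0" for k
  proof -
    have "\<epsilon> * 1 \<le> \<epsilon> * h 0" using \<epsilon> h_ge by (intro mult_left_mono) auto
    then show ?thesis using main[of 0 k] by simp
  qed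
  then show ?thesis using \<epsilon> by blast
qed

text \<open>A subtree with inherited cover \<open>c\<close> survives no better than one whose root is labelled \<open>y > c\<close>,
because each child of that root inherits at least \<open>c\<close>.\<close>

lemma pmf_mult_survival_le:
  assumes "c < y" "1 \<le> n"
  shows "pmf \<mu> y * survival \<mu> UNIV n k c \<le> survival \<mu> UNIV n (Suc k) 0"
proof -
  let ?s = "survival \<mu> UNIV n k"
  let ?f = "\<lambda>z. if z \<in> UNIV \<and> 1 \<le> max 0 z then 1 - (1 - ?s (max 0 z - 1)) ^ n else 0"
  have "pmf \<mu> y * ?s c = measure_pmf.expectation \<mu> (\<lambda>z. indicator {y} z * ?s c)"
    by (simp add: measure_pmf_single)
  also have "\<dots> \<le> measure_pmf.expectation \<mu> ?f"
  proof (rule integral_mono)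
    show "integrable (measure_pmf \<mu>) ?f"
      by (rule integrable_transfer[OF bounded_offspring_survival])
    show "integrable (measure_pmf \<mu>) (\<lambda>z. indicator {y} z * ?s c)"
      by (intro measure_pmf.integrable_const_bound[where B=1])
         (auto simp: indicator_def survival_bounds abs_of_nonneg)
    fix z
    have "?s c \<le> 1 - (1 - ?s (y - 1)) ^ n"
    proof -
      have "?s c \<le> ?s (y - 1)" using assms by (intro monoD[OF mono_survival]) simp
      also have "(1 - ?s (y - 1)) ^ n \<le> (1 - ?s (y - 1)) ^ 1"
        using assms survival_bounds[of \<mu> UNIV n k "y - 1"] by (intro power_decreasing) auto
      then have "?s (y - 1) \<le> 1 - (1 - ?s (y - 1)) ^ n" by simp
      finally show ?thesis .
    qed
    then show "indicator {y} z * ?s c \<le> ?f z"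
      using assms offspring_bounds(1)[OF survival_bounds, of \<mu> UNIV n k "max 0 z - 1" n]
      by (auto simp: indicator_def)
  qed
  finally show ?thesis by (simp add: transfer_def)
qed

section \<open>Types and truncation of the labels\<close>

lemma types_cases:
  assumes "pmf \<mu> 0 < 1"
  obtains (unbounded) "\<not> bdd_above (set_pmf \<mu>)" "types \<mu> = {1..}"
  | (bounded) n0 where "1 \<le> n0" "set_pmf \<mu> \<subseteq> {..n0}" "n0 \<in> set_pmf \<mu>" "types \<mu> = {1..n0}"
proof (cases "bdd_above (set_pmf \<mu>)")
  case False
  then have "types \<mu> = {1..}" by (auto simp: types_def state_space_def)
  with False show ?thesis by (rule unbounded)
next
  case True
  let ?A = "{k. 1 \<le> k \<and> pmf \<mu> k \<noteq> 0}"
  have A: "?A = set_pmf \<mu> - {0}" by (auto simp: set_pmf_iff)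
  have fin: "finite ?A" unfolding A using True by (simp add: bdd_above_nat)
  have ne: "?A \<noteq> {}"
  proof
    assume "?A = {}"
    then have "set_pmf \<mu> \<subseteq> {0}" unfolding A by blast
    then have "\<mu> = return_pmf 0" by (simp add: set_pmf_subset_singleton)
    then show False using assms by simp
  qed
  have "Sup ?A \<in> ?A" "\<forall>k\<in>?A. k \<le> Sup ?A"
    using Max_in[OF fin ne] Max_ge[OF fin] cSup_eq_Max[OF fin ne] by auto
  moreover from this have "set_pmf \<mu> \<subseteq> {..Sup ?A}"
    by (metis (no_types, lifting) A DiffI atMost_iff singletonD subsetI zero_le)
  moreover have "types \<mu> = {1..Sup ?A}" using True by (auto simp: types_def state_space_def)
  ultimately show ?thesis using bounded[of "Sup ?A"] A by blast
qed

lemma atMost_types: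
  assumes "N \<in> types \<mu>" "1 \<le> k" "k \<le> N"
  shows "k \<in> types \<mu>"
  using assms by (auto simp: types_def state_space_def split: if_splits)

text \<open>Labels of probability zero do not matter, so for bounded support every truncation level above the
largest label \<open>n\<^sub>0\<close> may be lowered to \<open>n\<^sub>0\<close>, which is a type.\<close>

lemma supercritical_cong:
  assumes "S \<inter> set_pmf \<mu> = S' \<inter> set_pmf \<mu>"
  shows "supercritical \<mu> S n = supercritical \<mu> S' n"
proof -
  have "measure_pmf.prob \<mu> (A \<inter> S) = measure_pmf.prob \<mu> (A \<inter> S')" for A
  proof -
    have "A \<inter> S \<inter> set_pmf \<mu> = A \<inter> S' \<inter> set_pmf \<mu>" using assms by blast
    then show ?thesis
      using measure_Int_set_pmf[of \<mu> "A \<inter> S"] measure_Int_set_pmf[of \<mu> "A \<inter> S'"] by simp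
  qed
  then show ?thesis by (simp add: supercritical_def nearest_mass_def uncover_mass_def)
qed

text \<open>The level \<open>N\<close> is required to be a type so that \<open>1, \<dots>, N\<close> are indices of the matrix.\<close>

lemma supercritical_truncate:
  assumes "supercritical \<mu> UNIV n" "pmf \<mu> 0 < 1"
  obtains N where "N \<in> types \<mu>" "supercritical \<mu> {..N} n"
proof -
  obtain K where K: "1 < (\<Sum>k<K. nearest_mass \<mu> UNIV k * real n ^ Suc k)"
    using assms(1) by (auto simp: supercritical_def)
  have lim: "(\<lambda>N. measure_pmf.prob \<mu> (A \<inter> {..N})) \<longlonglongrightarrow> measure_pmf.prob \<mu> (A \<inter> UNIV)" for A :: "nat set"
  proof -
    have "(\<lambda>N. measure_pmf.prob \<mu> (A \<inter> {..N})) \<longlonglongrightarrow> measure_pmf.prob \<mu> (\<Union>N. A \<inter> {..N})"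
      by (rule measure_pmf.finite_Lim_measure_incseq) (auto simp: incseq_def)
    moreover have "(\<Union>N. A \<inter> {..N}) = A \<inter> UNIV" by auto
    ultimately show ?thesis by simp
  qed
  have "(\<lambda>N. \<Sum>k<K. nearest_mass \<mu> {..N} k * real n ^ Suc k) \<longlonglongrightarrow> (\<Sum>k<K. nearest_mass \<mu> UNIV k * real n ^ Suc k)"
    unfolding nearest_mass_def uncover_mass_def by (intro tendsto_intros lim)
  then have ev: "eventually (\<lambda>N. 1 < (\<Sum>k<K. nearest_mass \<mu> {..N} k * real n ^ Suc k)) sequentially"
    using K by (rule order_tendstoD)
  have big: "\<exists>N\<ge>N0. supercritical \<mu> {..N} n" for N0
  proof -
    have "eventually (\<lambda>N. N0 \<le> N \<and> 1 < (\<Sum>k<K. nearest_mass \<mu> {..N} k * real n ^ Suc k)) sequentially"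
      by (intro eventually_conj ev eventually_ge_at_top)
    then obtain N where "N0 \<le> N \<and> 1 < (\<Sum>k<K. nearest_mass \<mu> {..N} k * real n ^ Suc k)"
      using eventually_happens'[OF sequentially_bot] by blast
    then show ?thesis unfolding supercritical_def by blast
  qed
  from assms(2) show ?thesis
  proof (cases rule: types_cases)
    case unbounded
    then show ?thesis using big[of 1] that by auto
  next
    case (bounded n0)
    obtain N where N: "n0 \<le> N" "supercritical \<mu> {..N} n" using big by blast
    have "{..N} \<inter> set_pmf \<mu> = {..n0} \<inter> set_pmf \<mu>" using bounded N by auto
    then have "supercritical \<mu> {..n0} n" using N(2) supercritical_cong by blast
    then show ?thesis using bounded that by auto
  qed
qed

section \<open>The spectral radius\<close>

lemma trans_matrix_nonneg: "0 \<le> trans_matrix \<mu> x y"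
  by (auto simp: trans_matrix_def intro!: sum_nonneg)

text \<open>The matrix is the transition kernel of the type along a ray, so its rows are the laws of
\<open>max (x - 1) Y\<close>; the index \<open>x\<close> is a type, whereas the transfer operator takes the inherited cover
\<open>x - 1\<close>.\<close>

lemma pmf_map_max:
  assumes "1 \<le> x" "1 \<le> z"
  shows "pmf (map_pmf (max (x - 1)) \<mu>) z = trans_matrix \<mu> x z"
proof -
  have "pmf (map_pmf (max (x - 1)) \<mu>) z = measure_pmf.prob \<mu> {y. max (x - 1) y = z}"
    by (simp add: pmf_map vimage_def)
  also have "{y. max (x - 1) y = z} = (if x \<le> z then {z} else if Suc z = x then {..<x} else {})"
    using assms by (auto simp: max_def split: if_splits)
  also have "measure_pmf.prob \<mu> \<dots> = trans_matrix \<mu> x z"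
    by (simp add: trans_matrix_def measure_pmf_single measure_measure_pmf_finite)
  finally show ?thesis .
qed

lemma trans_matrix_outside_types:
  assumes "x \<in> types \<mu>" "1 \<le> z" "z \<notin> types \<mu>" "pmf \<mu> 0 < 1"
  shows "trans_matrix \<mu> x z = 0"
  using assms(4)
proof (cases rule: types_cases)
  case (bounded n0)
  then have "x \<le> z" "z \<notin> set_pmf \<mu>" using assms by auto
  then show ?thesis by (simp add: trans_matrix_def set_pmf_iff)
qed (use assms in auto)

lemma has_sum_transfer:
  assumes x: "x \<in> types \<mu>" and h: "bounded (range h)" and \<mu>: "pmf \<mu> 0 < 1"
  shows "((\<lambda>z. trans_matrix \<mu> x z * h (z - 1)) has_sum transfer \<mu> UNIV h (x - 1)) (types \<mu>)"
proof -
  let ?p = "map_pmf (max (x - 1)) \<mu>"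
  define G where "G z = (if 1 \<le> z then h (z - 1) else 0)" for z
  obtain B where B: "\<And>c. \<bar>h c\<bar> \<le> B" using h by (auto simp: bounded_iff)
  have G: "\<bar>G z\<bar> \<le> B" for z using B[of "z - 1"] B[of 0] by (auto simp: G_def)
  have "transfer \<mu> UNIV h (x - 1) = measure_pmf.expectation ?p G"
    by (simp add: transfer_def G_def integral_map_pmf)
  moreover have "((\<lambda>z. pmf ?p z * G z) has_sum measure_pmf.expectation ?p G) UNIV"
  proof (rule norm_summable_imp_has_sum)
    show "(\<lambda>z. pmf ?p z * G z) sums measure_pmf.expectation ?p G"
      by (rule measure_pmf_expectation_nat_sums, rule G)
    have "(\<lambda>z. pmf ?p z * \<bar>G z\<bar>) sums measure_pmf.expectation ?p (\<lambda>z. \<bar>G z\<bar>)"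
      by (rule measure_pmf_expectation_nat_sums[where B=B]) (simp add: G)
    then show "summable (\<lambda>z. norm (pmf ?p z * G z))"
      by (simp add: abs_mult sums_iff)
  qed
  moreover have "((\<lambda>z. pmf ?p z * G z) has_sum s) UNIV \<longleftrightarrow>
      ((\<lambda>z. trans_matrix \<mu> x z * h (z - 1)) has_sum s) (types \<mu>)" for s
  proof (rule has_sum_cong_neutral)
    have x1: "1 \<le> x" using x by (auto simp: types_def)
    fix z
    { assume "z \<in> UNIV - types \<mu>"
      then have "z = 0 \<or> 1 \<le> z \<and> trans_matrix \<mu> x z = 0"
        using trans_matrix_outside_types[OF x _ _ \<mu>, of z] by (cases z) auto
      then show "pmf ?p z * G z = 0" using pmf_map_max[OF x1, of z \<mu>] by (auto simp: G_def) }
    { assume "z \<in> UNIV \<inter> types \<mu>"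
      then have "1 \<le> z" by (auto simp: types_def)
      then show "pmf ?p z * G z = trans_matrix \<mu> x z * h (z - 1)"
        using pmf_map_max[OF x1, of z \<mu>] by (simp add: G_def) }
  qed auto
  ultimately show ?thesis by simp
qed

locale label_law =
  fixes \<mu> :: "nat pmf"
  assumes pmf_0_pos: "0 < pmf \<mu> 0" and pmf_0_less_1: "pmf \<mu> 0 < 1"
begin

abbreviation "P \<equiv> mat_pow (types \<mu>) (trans_matrix \<mu>)"

lemma one_in_types: "1 \<in> types \<mu>"
  using pmf_0_less_1 by (cases rule: types_cases) auto

lemma transfer_eq_finite_sum:
  assumes N: "N \<in> types \<mu>" and x: "1 \<le> x" "x \<le> N" and h: "bounded (range h)"
  shows "transfer \<mu> {..N} h (x - 1) = (\<Sum>z\<in>{1..N}. trans_matrix \<mu> x z * h (z - 1))"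
proof -
  \<comment> \<open>For \<open>x \<le> N\<close>, forbidding labels above \<open>N\<close> amounts to forbidding types above \<open>N\<close>.\<close>
  define h' where "h' d = (if d < N then h d else 0)" for d
  obtain B where B: "\<And>c. \<bar>h c\<bar> \<le> B" using h by (auto simp: bounded_iff)
  have "bounded (range h')"
  proof -
    have "\<bar>h' c\<bar> \<le> B" for c using B[of c] B[of 0] by (auto simp: h'_def)
    then show ?thesis by (auto simp: bounded_iff)
  qed
  have xt: "x \<in> types \<mu>" using atMost_types[OF N] x by simp
  have "transfer \<mu> {..N} h (x - 1) = transfer \<mu> UNIV h' (x - 1)"
    unfolding transfer_def using x
    by (intro arg_cong[where f="measure_pmf.expectation \<mu>"])
       (auto simp: h'_def fun_eq_iff max_def)
  moreover have "((\<lambda>z. trans_matrix \<mu> x z * h' (z - 1)) has_sum transfer \<mu> UNIV h' (x - 1)) (types \<mu>)"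
    by (intro has_sum_transfer pmf_0_less_1) fact+
  moreover have "((\<lambda>z. trans_matrix \<mu> x z * h' (z - 1)) has_sum s) (types \<mu>) \<longleftrightarrow>
      ((\<lambda>z. trans_matrix \<mu> x z * h (z - 1)) has_sum s) {1..N}" for s
  proof (rule has_sum_cong_neutral)
    fix z assume "z \<in> {1..N} - types \<mu>"
    then show "trans_matrix \<mu> x z * h (z - 1) = 0" using atMost_types[OF N] by auto
  qed (auto simp: h'_def types_def)
  moreover have "((\<lambda>z. trans_matrix \<mu> x z * h (z - 1)) has_sum
      (\<Sum>z\<in>{1..N}. trans_matrix \<mu> x z * h (z - 1))) {1..N}"
    by (rule has_sum_finite) simp
  ultimately show ?thesis using has_sum_unique by metis
qed

text \<open>The three claims need a common induction: summability at one power comes from the bound by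
\<^const>\<open>cover_mass\<close>, which is obtained by summing at the previous power.\<close>

lemma mat_pow_bounds_summable:
  assumes "x \<in> types \<mu>"
  shows "0 \<le> P m x y" "P m x y \<le> cover_mass \<mu> UNIV m (x - 1)"
    "(\<lambda>z. trans_matrix \<mu> x z * P m z y) summable_on types \<mu>"
proof -
  have sum: "(\<lambda>z. trans_matrix \<mu> x z * P m z y) summable_on types \<mu>"
    if "x \<in> types \<mu>" "\<forall>z\<in>types \<mu>. 0 \<le> P m z y \<and> P m z y \<le> cover_mass \<mu> UNIV m (z - 1)" for m x
  proof (rule summable_on_comparison_test)
    show "(\<lambda>z. trans_matrix \<mu> x z * cover_mass \<mu> UNIV m (z - 1)) summable_on types \<mu>"
      using has_sum_transfer[OF that(1) bounded_cover_mass pmf_0_less_1] has_sum_imp_summable by blast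
  qed (use that in \<open>auto intro!: mult_left_mono simp: trans_matrix_nonneg\<close>)
  have *: "\<forall>x\<in>types \<mu>. 0 \<le> P m x y \<and> P m x y \<le> cover_mass \<mu> UNIV m (x - 1)" for m
  proof (induction m)
    case (Suc m)
    show ?case
    proof
      fix x assume x: "x \<in> types \<mu>"
      note st = has_sum_transfer[OF x bounded_cover_mass[of \<mu> UNIV m] pmf_0_less_1]
      have "0 \<le> P (Suc m) x y"
        using Suc.IH by (auto intro!: infsum_nonneg mult_nonneg_nonneg simp: trans_matrix_nonneg)
      moreover have "P (Suc m) x y \<le> (\<Sum>\<^sub>\<infinity>z\<in>types \<mu>. trans_matrix \<mu> x z * cover_mass \<mu> UNIV m (z - 1))"
        unfolding mat_pow.simps
        by (rule infsum_mono[OF sum[OF x Suc.IH] has_sum_imp_summable[OF st]])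
           (use Suc.IH in \<open>auto intro!: mult_left_mono simp: trans_matrix_nonneg\<close>)
      moreover have "\<dots> = cover_mass \<mu> UNIV (Suc m) (x - 1)" using infsumI[OF st] by simp
      ultimately show "0 \<le> P (Suc m) x y \<and> P (Suc m) x y \<le> cover_mass \<mu> UNIV (Suc m) (x - 1)" by simp
    qed
  qed simp
  show "0 \<le> P m x y" "P m x y \<le> cover_mass \<mu> UNIV m (x - 1)"
    "(\<lambda>z. trans_matrix \<mu> x z * P m z y) summable_on types \<mu>"
    using * sum assms by blast+
qed

lemma mat_pow_le_1: "x \<in> types \<mu> \<Longrightarrow> P m x y \<le> 1"
  using mat_pow_bounds_summable(2)[of x m y] cover_mass_bounds(2)[of \<mu> UNIV m "x - 1"] by linarith

lemma mat_pow_Suc_ge_sum: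
  assumes "x \<in> types \<mu>" "finite F" "F \<subseteq> types \<mu>"
  shows "(\<Sum>z\<in>F. trans_matrix \<mu> x z * P m z y) \<le> P (Suc m) x y"
  unfolding mat_pow.simps using assms
  by (intro finite_sum_le_infsum mat_pow_bounds_summable)
     (auto intro!: mult_nonneg_nonneg mat_pow_bounds_summable simp: trans_matrix_nonneg)

lemma mat_pow_mult_le:
  assumes "x \<in> types \<mu>" "y \<in> types \<mu>"
  shows "P a x y * P b y z \<le> P (a + b) x z"
  using assms(1)
proof (induction a arbitrary: x)
  case 0
  then show ?case using mat_pow_bounds_summable(1)[of x b z] by simp
next
  case (Suc a)
  have "P (Suc a) x y * P b y z = (\<Sum>\<^sub>\<infinity>w\<in>types \<mu>. trans_matrix \<mu> x w * P a w y * P b y z)"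
    by (simp add: infsum_cmult_left')
  also have "\<dots> \<le> (\<Sum>\<^sub>\<infinity>w\<in>types \<mu>. trans_matrix \<mu> x w * P (a + b) w z)"
  proof (rule infsum_mono)
    show "(\<lambda>w. trans_matrix \<mu> x w * P a w y * P b y z) summable_on types \<mu>"
      by (rule summable_on_cmult_left) (rule mat_pow_bounds_summable(3)[OF Suc.prems])
    show "(\<lambda>w. trans_matrix \<mu> x w * P (a + b) w z) summable_on types \<mu>"
      by (rule mat_pow_bounds_summable(3)[OF Suc.prems])
    show "trans_matrix \<mu> x w * P a w y * P b y z \<le> trans_matrix \<mu> x w * P (a + b) w z"
      if "w \<in> types \<mu>" for w
      using mult_left_mono[OF Suc.IH[OF that] trans_matrix_nonneg] by (simp add: mult.assoc)
  qed
  finally show ?case by simp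
qed

lemma mat_pow_descend_pos:
  assumes "1 \<le> y" "y \<le> x" "x \<in> types \<mu>"
  shows "0 < P (x - y) x y"
  using assms(2,3)
proof (induction x rule: dec_induct)
  case (step x)
  have x: "x \<in> types \<mu>" "1 \<le> x" using atMost_types[OF step.prems, of x] step.hyps assms(1) by auto
  have "pmf \<mu> 0 \<le> (\<Sum>z<Suc x. pmf \<mu> z)" using member_le_sum[of 0 "{..<Suc x}" "pmf \<mu>"] by simp
  then have "0 < trans_matrix \<mu> (Suc x) x"
    using pmf_0_pos by (simp add: trans_matrix_def)
  then have "0 < trans_matrix \<mu> (Suc x) x * P (x - y) x y" using step.IH x by simp
  also have "\<dots> \<le> P (Suc (x - y)) (Suc x) y"
    using mat_pow_Suc_ge_sum[OF step.prems, of "{x}"] x by simp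
  finally show ?case using step.hyps by (simp add: Suc_diff_le)
qed simp

text \<open>Types descend one by one because \<open>\<mu>\<^sub>0 > 0\<close>, and jump up to any possible label; the detour through a
large label \<open>N\<close> therefore connects all pairs.\<close>

lemma mat_pow_irreducible:
  assumes "x \<in> types \<mu>" "y \<in> types \<mu>"
  shows "\<exists>m. 0 < P m x y"
proof -
  obtain N where N: "x \<le> N" "y \<le> N" "N \<in> types \<mu>" "0 < pmf \<mu> N"
    using pmf_0_less_1
  proof (cases rule: types_cases)
    case unbounded
    then obtain N where "N \<in> set_pmf \<mu>" "max x y < N" by (meson bdd_above_def not_le)
    then show ?thesis using unbounded that[of N] by (auto simp: pmf_positive)
  next
    case (bounded n0)
    then show ?thesis using assms that[of n0] by (auto simp: pmf_positive)
  qed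
  have "0 < trans_matrix \<mu> x N * P (N - y) N y"
    using N mat_pow_descend_pos[of y N] assms(2) by (auto simp: trans_matrix_def types_def)
  also have "\<dots> \<le> P (Suc (N - y)) x y"
    using mat_pow_Suc_ge_sum[OF assms(1), of "{N}"] N by simp
  finally show ?thesis by blast
qed

abbreviation "growth x y \<equiv> limsup (\<lambda>m. ereal (root m (P m x y)))"

text \<open>Detours of fixed length \<open>d\<close> and fixed weight \<open>\<kappa> > 0\<close> connect the two pairs of indices. The \<open>m\<close>-th
root makes the weight disappear, and changing the root from \<open>m\<close> to \<open>m + d\<close> goes in the right
direction because the entries are at most \<open>1\<close>.\<close>

lemma growth_le:
  assumes "x \<in> types \<mu>" "y \<in> types \<mu>" "x' \<in> types \<mu>" "y' \<in> types \<mu>"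
  shows "growth x y \<le> growth x' y'"
proof -
  obtain a b where ab: "0 < P a x' x" "0 < P b y y'"
    using mat_pow_irreducible assms by blast
  define \<kappa> where "\<kappa> = P a x' x * P b y y'"
  define d where "d = a + b"
  have \<kappa>: "0 < \<kappa>" using ab by (simp add: \<kappa>_def)
  have le: "\<kappa> * P m x y \<le> P (m + d) x' y'" for m
  proof -
    have "\<kappa> * P m x y = P a x' x * P m x y * P b y y'" by (simp add: \<kappa>_def)
    also have "\<dots> \<le> P (a + m) x' y * P b y y'"
      using mat_pow_mult_le[OF assms(3,1), of a m y] ab by (intro mult_right_mono) auto
    also have "\<dots> \<le> P (a + m + b) x' y'" by (rule mat_pow_mult_le[OF assms(3,2)])
    finally show ?thesis by (simp add: d_def add.commute add.left_commute)
  qed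
  have ev: "eventually (\<lambda>m. ereal (root (m + d) \<kappa>) * ereal (root m (P m x y)) \<le>
      ereal (root (m + d) (P (m + d) x' y'))) sequentially"
    using eventually_gt_at_top[of 0]
  proof eventually_elim
    case (elim m)
    have "root m (P m x y) \<le> root (m + d) (P m x y)"
      using elim mat_pow_bounds_summable(1)[OF assms(1), of m y] mat_pow_le_1[OF assms(1), of m y]
      by (cases "d = 0") (auto intro!: real_root_increasing)
    then have "root (m + d) \<kappa> * root m (P m x y) \<le> root (m + d) \<kappa> * root (m + d) (P m x y)"
      using \<kappa> elim by (intro mult_left_mono) auto
    also have "\<dots> = root (m + d) (\<kappa> * P m x y)" by (simp add: real_root_mult)
    also have "\<dots> \<le> root (m + d) (P (m + d) x' y')" using elim le by simp
    finally show ?case by simp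
  qed
  have "(\<lambda>m. root (m + d) \<kappa>) \<longlonglongrightarrow> 1"
    using LIMSEQ_ignore_initial_segment[OF LIMSEQ_root_const[OF \<kappa>]] .
  then have "(\<lambda>m. ereal (root (m + d) \<kappa>)) \<longlonglongrightarrow> 1" by (simp add: one_ereal_def)
  then have "growth x y = limsup (\<lambda>m. ereal (root (m + d) \<kappa>) * ereal (root m (P m x y)))"
    by (subst ereal_limsup_lim_mult[where a = 1]) auto
  also have "\<dots> \<le> limsup (\<lambda>m. ereal (root (m + d) (P (m + d) x' y')))"
    by (rule Limsup_mono[OF ev])
  also have "\<dots> = growth x' y'" by (rule limsup_shift_k)
  finally show ?thesis .
qed

lemma rho_M_eq_growth:
  assumes "x \<in> types \<mu>" "y \<in> types \<mu>"
  shows "rho_M \<mu> = growth x y"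
  unfolding rho_M_def conv_rho_def
proof (rule the_equality)
  show "\<forall>x'\<in>types \<mu>. \<forall>y'\<in>types \<mu>. growth x' y' = growth x y"
    using growth_le assms by (auto intro!: antisym)
  show "r = growth x y" if "\<forall>x\<in>types \<mu>. \<forall>y\<in>types \<mu>. growth x y = r" for r
    using that assms by auto
qed

lemma rho_M_le_if_not_supercritical:
  assumes "\<not> supercritical \<mu> UNIV n" "1 \<le> n"
  shows "rho_M \<mu> \<le> ereal (1 / real n)"
proof -
  have "eventually (\<lambda>m. ereal (root m (P m 1 1)) \<le> ereal (1 / real n)) sequentially"
    using eventually_gt_at_top[of 0]
  proof eventually_elim
    case (elim m)
    have "P m 1 1 \<le> cover_mass \<mu> UNIV m 0"
      using mat_pow_bounds_summable(2)[OF one_in_types, of m 1] by simp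
    also have "\<dots> \<le> (1 / real n) ^ m"
      using cover_mass_le_if_not_supercritical[OF assms(1), of m] assms(2)
      by (simp add: power_divide field_simps)
    finally have "root m (P m 1 1) \<le> root m ((1 / real n) ^ m)" using elim by simp
    then show ?case using elim by (simp add: real_root_power_cancel)
  qed
  then have "growth 1 1 \<le> ereal (1 / real n)" by (rule Limsup_bounded)
  then show ?thesis using rho_M_eq_growth[OF one_in_types one_in_types] by simp
qed

text \<open>Paths with labels at most \<open>N\<close> stay within the types \<open>1, \<dots>, N\<close>.\<close>

lemma cover_mass_le_row_sum:
  assumes N: "N \<in> types \<mu>" and x: "x \<in> {1..N}"
  shows "cover_mass \<mu> {..N} m (x - 1) \<le> (\<Sum>y\<in>{1..N}. P m x y)"
  using x
proof (induction m arbitrary: x)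
  case (Suc m)
  have sub: "{1..N} \<subseteq> types \<mu>" using atMost_types[OF N] by auto
  have "cover_mass \<mu> {..N} (Suc m) (x - 1) = (\<Sum>z\<in>{1..N}. trans_matrix \<mu> x z * cover_mass \<mu> {..N} m (z - 1))"
    using transfer_eq_finite_sum[OF N _ _ bounded_cover_mass] Suc.prems by simp
  also have "\<dots> \<le> (\<Sum>z\<in>{1..N}. trans_matrix \<mu> x z * (\<Sum>y\<in>{1..N}. P m z y))"
    using Suc.IH by (intro sum_mono mult_left_mono trans_matrix_nonneg)
  also have "\<dots> = (\<Sum>y\<in>{1..N}. \<Sum>z\<in>{1..N}. trans_matrix \<mu> x z * P m z y)"
    by (simp only: sum_distrib_left) (rule sum.swap)
  also have "\<dots> \<le> (\<Sum>y\<in>{1..N}. P (Suc m) x y)"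
    using sub Suc.prems by (intro sum_mono mat_pow_Suc_ge_sum) auto
  finally show ?case .
qed simp

text \<open>If all entries of the first row had growth rate at most \<open>1/n < 1/t\<close>, then so would the finite row
sum over \<open>1, \<dots>, N\<close>, against the lower bound \<open>s\<^bsup>-m\<^esup>\<close> with \<open>s < t\<close>.\<close>

lemma rho_M_gt_if_supercritical:
  assumes "supercritical \<mu> UNIV n" "1 \<le> n"
  shows "ereal (1 / real n) < rho_M \<mu>"
proof (rule ccontr)
  assume "\<not> ?thesis"
  then have rho: "rho_M \<mu> \<le> ereal (1 / real n)" by simp
  obtain N where N: "N \<in> types \<mu>" "supercritical \<mu> {..N} n"
    using supercritical_truncate[OF assms(1) pmf_0_less_1] by blast
  obtain s c where s: "0 < s" "s < real n" "0 < c" "\<And>m. c \<le> s ^ m * cover_mass \<mu> {..N} m 0"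
    using supercritical_growth[OF N(2) assms(2)] by blast
  obtain t where t: "s < t" "t < real n" using dense[OF s(2)] by blast
  have "eventually (\<lambda>m. P m 1 y \<le> (1 / t) ^ m) sequentially" if "y \<in> {1..N}" for y
  proof -
    have y: "y \<in> types \<mu>" using atMost_types[OF N(1)] that by simp
    have "growth 1 y \<le> ereal (1 / real n)" using rho rho_M_eq_growth[OF one_in_types y] by simp
    also have "\<dots> < ereal (1 / t)" using s t by (simp add: field_simps)
    finally have "eventually (\<lambda>m. ereal (root m (P m 1 y)) < ereal (1 / t)) sequentially"
      by (rule Limsup_lessD)
    with eventually_gt_at_top[of 0] show ?thesis
    proof eventually_elim
      case (elim m)
      have nn: "0 \<le> P m 1 y" by (rule mat_pow_bounds_summable(1)[OF one_in_types])
      then have "P m 1 y = root m (P m 1 y) ^ m" using elim by simp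
      also have "\<dots> \<le> (1 / t) ^ m" using elim nn by (intro power_mono) auto
      finally show ?case .
    qed
  qed
  then have "eventually (\<lambda>m. \<forall>y\<in>{1..N}. P m 1 y \<le> (1 / t) ^ m) sequentially"
    by (simp add: eventually_ball_finite)
  moreover have "eventually (\<lambda>m. real N * (s / t) ^ m < c) sequentially"
  proof -
    have "(\<lambda>m. real N * (s / t) ^ m) \<longlonglongrightarrow> real N * 0"
      using s t by (intro tendsto_intros LIMSEQ_power_zero) simp
    then show ?thesis using s(3) by (intro order_tendstoD(2)) auto
  qed
  ultimately have "eventually (\<lambda>m. (\<forall>y\<in>{1..N}. P m 1 y \<le> (1 / t) ^ m) \<and>
      real N * (s / t) ^ m < c) sequentially"
    by (rule eventually_conj)
  then obtain m where m: "\<And>y. y \<in> {1..N} \<Longrightarrow> P m 1 y \<le> (1 / t) ^ m" "real N * (s / t) ^ m < c"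
    using eventually_happens'[OF sequentially_bot] by blast
  have "1 \<le> N" using N(1) by (auto simp: types_def)
  then have "cover_mass \<mu> {..N} m 0 \<le> (\<Sum>y\<in>{1..N}. P m 1 y)"
    using cover_mass_le_row_sum[OF N(1), of 1 m] by simp
  also have "\<dots> \<le> (\<Sum>y\<in>{1..N}. (1 / t) ^ m)" by (intro sum_mono m)
  finally have "cover_mass \<mu> {..N} m 0 \<le> real N * (1 / t) ^ m" by simp
  then have "s ^ m * cover_mass \<mu> {..N} m 0 \<le> s ^ m * (real N * (1 / t) ^ m)"
    using s by (intro mult_left_mono) auto
  also have "\<dots> = real N * (s / t) ^ m" by (simp add: power_divide)
  finally show False using m(2) s(4)[of m] by linarith
qed

lemma rho_M_gt_iff_supercritical:
  "1 \<le> n \<Longrightarrow> ereal (1 / real n) < rho_M \<mu> \<longleftrightarrow> supercritical \<mu> UNIV n"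
  using rho_M_gt_if_supercritical rho_M_le_if_not_supercritical by (meson not_le)

end

section \<open>Events of finite depth in a tree of independent labels\<close>

text \<open>An event decided by exploring the tree downwards: at height \<open>h\<close> a vertex in state \<open>c\<close> with label \<open>y\<close>
has to satisfy \<open>ok h c y\<close> and to have a child that passes from state \<open>step h c y\<close> at height \<open>h - 1\<close>.
Survival to a given depth, survival of some subtree at a given level and the existence of an
uncovered vertex on a given level are all instances, so independence of subtrees is used only
once.\<close>

fun pass ::
  "nat \<Rightarrow> (nat \<Rightarrow> nat \<Rightarrow> nat \<Rightarrow> bool) \<Rightarrow> (nat \<Rightarrow> nat \<Rightarrow> nat \<Rightarrow> nat) \<Rightarrow> (nat list \<Rightarrow> nat) \<Rightarrow> nat \<Rightarrow> nat \<Rightarrow>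
    nat list \<Rightarrow> bool" where
  "pass n ok step Y 0 c v \<longleftrightarrow> ok 0 c (Y v)"
| "pass n ok step Y (Suc h) c v \<longleftrightarrow>
     ok (Suc h) c (Y v) \<and> (\<exists>j\<in>{1..n}. pass n ok step Y h (step (Suc h) c (Y v)) (v @ [j]))"

fun pass_prob ::
  "nat pmf \<Rightarrow> nat \<Rightarrow> (nat \<Rightarrow> nat \<Rightarrow> nat \<Rightarrow> bool) \<Rightarrow> (nat \<Rightarrow> nat \<Rightarrow> nat \<Rightarrow> nat) \<Rightarrow> nat \<Rightarrow> nat \<Rightarrow> real" where
  "pass_prob \<mu> n ok step 0 c = measure_pmf.prob \<mu> {y. ok 0 c y}"
| "pass_prob \<mu> n ok step (Suc h) c =
     measure_pmf.expectation \<mu> (\<lambda>y. if ok (Suc h) c y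
        then 1 - (1 - pass_prob \<mu> n ok step h (step (Suc h) c y)) ^ n else 0)"

lemma pass_cong:
  assumes "\<And>w. w \<in> verts n \<Longrightarrow> Y (v @ w) = Y' (v @ w)"
  shows "pass n ok step Y h c v = pass n ok step Y' h c v"
  using assms
proof (induction h arbitrary: c v)
  case 0
  then show ?case using 0[of "[]"] by simp
next
  case (Suc h)
  have "pass n ok step Y h d (v @ [j]) = pass n ok step Y' h d (v @ [j])" if "j \<in> {1..n}" for d j
    using that Suc.prems[of "j # _"] by (intro Suc.IH) auto
  then show ?case using Suc.prems[of "[]"] by auto
qed

lemma measurable_pass:
  assumes "\<And>w. w \<in> verts n \<Longrightarrow> (\<lambda>f. Y f (v @ w)) \<in> N \<rightarrow>\<^sub>M count_space UNIV"
  shows "Measurable.pred N (\<lambda>f. pass n ok step (Y f) h c v)"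
  using assms
proof (induction h arbitrary: c v)
  case 0
  have [measurable]: "(\<lambda>f. Y f v) \<in> N \<rightarrow>\<^sub>M count_space UNIV" using 0[of "[]"] by simp
  show ?case by simp
next
  case (Suc h)
  have [measurable]: "(\<lambda>f. Y f v) \<in> N \<rightarrow>\<^sub>M count_space UNIV" using Suc.prems[of "[]"] by simp
  have [measurable]: "Measurable.pred N (\<lambda>f. pass n ok step (Y f) h d (v @ [j]))"
    if "j \<in> {1..n}" for d j
    using that Suc.prems[of "j # _"] by (intro Suc.IH) auto
  have eq: "pass n ok step (Y f) (Suc h) c v \<longleftrightarrow>
      (\<exists>y. Y f v = y \<and> ok (Suc h) c y \<and>
         (\<exists>j\<in>{1..n}. pass n ok step (Y f) h (step (Suc h) c y) (v @ [j])))" for f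
    by auto
  show ?case unfolding eq by measurable
qed

text \<open>The independent labels of the tree. Only the values of \<open>Y\<close> on \<^term>\<open>verts n\<close> are random variables of
law \<open>\<mu>\<close>, so measurability below always refers to a vertex.\<close>

locale labelled_tree = prob_space M for M :: "'a measure" +
  fixes n :: nat and \<mu> :: "nat pmf" and Y :: "nat list \<Rightarrow> 'a \<Rightarrow> nat"
  assumes indep: "indep_vars (\<lambda>_. count_space UNIV) Y (verts n)"
    and law: "x \<in> verts n \<Longrightarrow> prob {\<omega> \<in> space M. Y x \<omega> = k} = pmf \<mu> k"
begin

abbreviation lab :: "'a \<Rightarrow> nat list \<Rightarrow> nat" where
  "lab \<omega> \<equiv> (\<lambda>x. Y x \<omega>)"

lemma measurable_label: "x \<in> verts n \<Longrightarrow> Y x \<in> M \<rightarrow>\<^sub>M count_space UNIV"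
  using indep by (auto simp: indep_vars_def)

lemma measurable_pass_lab:
  "v \<in> verts n \<Longrightarrow> Measurable.pred M (\<lambda>\<omega>. pass n ok step (lab \<omega>) h c v)"
  by (rule measurable_pass) (simp add: measurable_label)

text \<open>The label of \<open>v\<close> and the subtrees of its children read disjoint sets of labels. The family of
restrictions of \<open>Y\<close> to these sets, with index \<open>0\<close> for the label itself and index \<open>j\<close> for the \<open>j\<close>-th
child, is independent.\<close>

lemma prob_label_subtrees:
  assumes v: "v \<in> verts n"
    and same: "\<And>j. j \<in> {1..n} \<Longrightarrow>
        prob {\<omega> \<in> space M. pass n ok step (lab \<omega>) h d (v @ [j])} = p"
  shows "prob {\<omega> \<in> space M. Y v \<omega> = y \<and> (\<forall>j\<in>{1..n}. \<not> pass n ok step (lab \<omega>) h d (v @ [j]))} =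
         pmf \<mu> y * (1 - p) ^ n"
proof -
  let ?L = "{0..n}"
  define K where "K j = (if j = 0 then {v} else (\<lambda>w. v @ j # w) ` verts n)" for j
  define X where "X = (\<lambda>j \<omega>. restrict (\<lambda>x. Y x \<omega>) (K j))"
  define N where "N j = Pi\<^sub>M (K j) (\<lambda>_. count_space UNIV :: nat measure)" for j
  define F where "F j = (if j = 0 then {f \<in> space (N j). f v = y}
      else {f \<in> space (N j). \<not> pass n ok step f h d (v @ [j])})" for j
  have indep_X: "indep_vars N X ?L"
    unfolding X_def N_def
  proof (rule indep_vars_restrict[OF indep])
    show "K j \<subseteq> verts n" if "j \<in> ?L" for j using v that by (auto simp: K_def)
    show "disjoint_family_on K ?L" by (auto simp: disjoint_family_on_def K_def)
  qed
  have F_sets: "F j \<in> sets (N j)" if "j \<in> ?L" for j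
  proof (cases "j = 0")
    case True
    have [measurable]: "(\<lambda>f. f v) \<in> N 0 \<rightarrow>\<^sub>M count_space UNIV"
      unfolding N_def K_def by (rule measurable_component_singleton) simp
    show ?thesis using True by (simp add: F_def)
  next
    case False
    have "Measurable.pred (N j) (\<lambda>f. pass n ok step f h d (v @ [j]))"
      using False
      by (intro measurable_pass) (auto simp: N_def K_def intro!: measurable_component_singleton)
    then show ?thesis using False by (simp add: F_def)
  qed
  have X_space: "X j \<omega> \<in> space (N j)" for j \<omega>
    by (auto simp: X_def N_def space_PiM)
  have vimage0: "X 0 -` F 0 \<inter> space M = {\<omega> \<in> space M. Y v \<omega> = y}"
    using X_space[of 0] by (auto simp: F_def) (auto simp: X_def K_def)
  have pass_X: "pass n ok step (X j \<omega>) h d (v @ [j]) = pass n ok step (lab \<omega>) h d (v @ [j])"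
    if "j \<noteq> 0" for j \<omega>
    using that by (intro pass_cong) (auto simp: X_def K_def)
  have vimage: "X j -` F j \<inter> space M =
      {\<omega> \<in> space M. \<not> pass n ok step (lab \<omega>) h d (v @ [j])}" if "j \<noteq> 0" for j
    using X_space[of j] pass_X[OF that] that by (auto simp: F_def)
  have "{\<omega> \<in> space M. Y v \<omega> = y \<and> (\<forall>j\<in>{1..n}. \<not> pass n ok step (lab \<omega>) h d (v @ [j]))} =
      (\<Inter>j\<in>?L. X j -` F j \<inter> space M)"
  proof -
    have "?L = insert 0 {1..n}" by auto
    then show ?thesis using vimage0 vimage by auto
  qed
  also have "prob \<dots> = (\<Prod>j\<in>?L. prob (X j -` F j \<inter> space M))"
    by (rule indep_varsD[OF indep_X]) (auto simp: F_sets)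
  also have "\<dots> = prob (X 0 -` F 0 \<inter> space M) * (\<Prod>j\<in>{1..n}. prob (X j -` F j \<inter> space M))"
    using prod.atLeast_Suc_atMost[of 0 n] by simp
  also have "(\<Prod>j\<in>{1..n}. prob (X j -` F j \<inter> space M)) = (\<Prod>j\<in>{1..n}. 1 - p)"
  proof (rule prod.cong)
    fix j assume j: "j \<in> {1..n}"
    then have [measurable]: "Measurable.pred M (\<lambda>\<omega>. pass n ok step (lab \<omega>) h d (v @ [j]))"
      using v by (intro measurable_pass_lab) simp
    show "prob (X j -` F j \<inter> space M) = 1 - p"
      using j same[OF j] vimage[of j]
      prob_neg[of "\<lambda>\<omega>. pass n ok step (lab \<omega>) h d (v @ [j])"] by simp
  qed simp
  finally show ?thesis using law[OF v] by (simp add: vimage0)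
qed

lemma prob_condition_on_label:
  assumes v: "v \<in> verts n"
    and meas: "\<And>y. Measurable.pred M (H y)"
    and cond: "\<And>y. prob {\<omega> \<in> space M. Y v \<omega> = y \<and> H y \<omega>} = pmf \<mu> y * f y"
    and f: "\<And>y. \<bar>f y\<bar> \<le> B"
  shows "prob {\<omega> \<in> space M. H (Y v \<omega>) \<omega>} = measure_pmf.expectation \<mu> f"
proof -
  let ?A = "\<lambda>y. {\<omega> \<in> space M. Y v \<omega> = y \<and> H y \<omega>}"
  note [measurable] = meas measurable_label[OF v]
  have "(\<lambda>y. prob (?A y)) sums prob (\<Union>y. ?A y)"
    by (rule finite_measure_UNION) (auto simp: disjoint_family_on_def)
  moreover have "(\<Union>y. ?A y) = {\<omega> \<in> space M. H (Y v \<omega>) \<omega>}" by auto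
  ultimately show ?thesis
    using sums_unique2[OF _ measure_pmf_expectation_nat_sums[of f B \<mu>]] f by (simp only: cond)
qed

lemma pass_prob_bounds: "0 \<le> pass_prob p k ok step h c" "pass_prob p k ok step h c \<le> 1"
proof -
  have "0 \<le> pass_prob p k ok step h c \<and> pass_prob p k ok step h c \<le> 1"
  proof (induction h arbitrary: c)
    case (Suc h)
    have bd: "0 \<le> 1 - (1 - pass_prob p k ok step h d) ^ k"
        "1 - (1 - pass_prob p k ok step h d) ^ k \<le> 1" for d
      using Suc.IH[of d] by (auto intro!: power_le_one)
    show ?case
      using bd by (auto intro!: measure_pmf.integral_le_const Bochner_Integration.integral_nonneg
        measure_pmf.integrable_const_bound[where B=1])
  qed (simp add: measure_pmf.prob_le_1)
  then show "0 \<le> pass_prob p k ok step h c" "pass_prob p k ok step h c \<le> 1" by auto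
qed

lemma prob_pass:
  "v \<in> verts n \<Longrightarrow>
     prob {\<omega> \<in> space M. pass n ok step (lab \<omega>) h c v} = pass_prob \<mu> n ok step h c"
proof (induction h arbitrary: c v)
  case 0
  have "prob {\<omega> \<in> space M. ok 0 c (Y v \<omega>)} =
      measure_pmf.expectation \<mu> (indicator {y. ok 0 c y})"
  proof (rule prob_condition_on_label[OF 0, where H = "\<lambda>y \<omega>. ok 0 c y" and B=1])
    show "prob {\<omega> \<in> space M. Y v \<omega> = y \<and> ok 0 c y} = pmf \<mu> y * indicator {y. ok 0 c y} y" for y
      using law[OF 0, of y] by (cases "ok 0 c y") auto
  qed (auto simp: indicator_def)
  then show ?case by simp
next
  case (Suc h)
  let ?p = "pass_prob \<mu> n ok step h"
  have v: "v \<in> verts n" by fact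
  note [measurable] = measurable_label[OF v]
  have vj: "v @ [j] \<in> verts n" if "j \<in> {1..n}" for j using that v by simp
  have some_pass: "Measurable.pred M (\<lambda>\<omega>. \<exists>j\<in>{1..n}. pass n ok step (lab \<omega>) h d (v @ [j]))" for d
    by (intro pred_intros_finite measurable_pass_lab vj) auto
  have label_eq: "Measurable.pred M (\<lambda>\<omega>. Y v \<omega> = y)" for y by measurable
  define H where "H y \<omega> \<longleftrightarrow> ok (Suc h) c y \<and>
      (\<exists>j\<in>{1..n}. pass n ok step (lab \<omega>) h (step (Suc h) c y) (v @ [j]))" for y \<omega>
  define f where "f y = (if ok (Suc h) c y then 1 - (1 - ?p (step (Suc h) c y)) ^ n else 0)" for y
  have H_meas: "Measurable.pred M (H y)" for y
    using some_pass by (cases "ok (Suc h) c y") (simp_all add: H_def[abs_def])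
  have "prob {\<omega> \<in> space M. H (Y v \<omega>) \<omega>} = measure_pmf.expectation \<mu> f"
  proof (rule prob_condition_on_label[OF v H_meas, where B=1])
    fix y
    have "0 \<le> (1 - ?p (step (Suc h) c y)) ^ n" "(1 - ?p (step (Suc h) c y)) ^ n \<le> 1"
      using pass_prob_bounds[of \<mu> n ok step h "step (Suc h) c y"] by (auto intro!: power_le_one)
    then show "\<bar>f y\<bar> \<le> 1" by (auto simp: f_def)
    show "prob {\<omega> \<in> space M. Y v \<omega> = y \<and> H y \<omega>} = pmf \<mu> y * f y"
    proof (cases "ok (Suc h) c y")
      case True
      let ?d = "step (Suc h) c y"
      let ?N = "{\<omega> \<in> space M. Y v \<omega> = y \<and> (\<forall>j\<in>{1..n}. \<not> pass n ok step (lab \<omega>) h ?d (v @ [j]))}"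
      have diff: "{\<omega> \<in> space M. Y v \<omega> = y \<and> H y \<omega>} = {\<omega> \<in> space M. Y v \<omega> = y} - ?N"
        using True by (auto simp: H_def)
      have "prob {\<omega> \<in> space M. Y v \<omega> = y \<and> H y \<omega>} =
          prob {\<omega> \<in> space M. Y v \<omega> = y} - prob ?N"
        unfolding diff
      proof (rule finite_measure_Diff)
        show "{\<omega> \<in> space M. Y v \<omega> = y} \<in> events" by (rule predE[OF label_eq])
        have N_eq: "?N = {\<omega> \<in> space M. Y v \<omega> = y} -
            {\<omega> \<in> space M. \<exists>j\<in>{1..n}. pass n ok step (lab \<omega>) h ?d (v @ [j])}" by blast
        show "?N \<in> events"
          unfolding N_eq by (intro sets.Diff predE[OF some_pass] predE[OF label_eq])
        show "?N \<subseteq> {\<omega> \<in> space M. Y v \<omega> = y}" by (rule Collect_mono) blast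
      qed
      moreover have "prob ?N = pmf \<mu> y * (1 - ?p ?d) ^ n"
        by (rule prob_label_subtrees[OF v], rule Suc.IH, rule vj)
      ultimately show ?thesis unfolding f_def if_P[OF True] law[OF v] by (simp only: algebra_simps)
    next
      case False
      then show ?thesis by (simp add: H_def f_def)
    qed
  qed
  then show ?case by (simp only: H_def f_def[abs_def] pass.simps pass_prob.simps)
qed

end

section \<open>Survival as an event on one labelling\<close>

text \<open>Koenig's lemma: a word with arbitrarily long extensions in \<open>T\<close> has a child with the same property.\<close>

lemma koenig_words:
  assumes closed: "\<And>w j. w @ [j] \<in> T \<Longrightarrow> w \<in> T" and sub: "T \<subseteq> verts n"
    and long: "\<And>k. \<exists>w\<in>T. length w = k"
  shows "\<exists>p. \<forall>i. p i \<in> T \<and> (p i, p (Suc i)) \<in> edges n"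
proof -
  have prefix: "u \<in> T" if "u @ w \<in> T" for u w
    using that
  proof (induction w rule: rev_induct)
    case (snoc j w)
    then show ?case using closed[of "u @ w" j] by simp
  qed simp
  define Q where "Q w \<longleftrightarrow> (\<forall>k. \<exists>w'. w @ w' \<in> T \<and> length w' = k)" for w
  have Q_T: "w \<in> T" if "Q w" for w using that prefix by (auto simp: Q_def)
  have extend: "\<exists>j\<in>{1..n}. Q (w @ [j])" if "Q w" for w
  proof (rule ccontr)
    assume "\<not> ?thesis"
    then have "\<forall>j\<in>{1..n}. \<exists>k. \<forall>w'. (w @ [j]) @ w' \<in> T \<longrightarrow> length w' \<noteq> k" by (auto simp: Q_def)
    then obtain k where k: "\<And>j w'. j \<in> {1..n} \<Longrightarrow> (w @ [j]) @ w' \<in> T \<Longrightarrow> length w' \<noteq> k j"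
      by metis
    define K where "K = Max (insert 0 (k ` {1..n}))"
    obtain u where u: "w @ u \<in> T" "length u = Suc K" using \<open>Q w\<close> unfolding Q_def by blast
    then obtain j u' where ju: "u = j # u'" "length u' = K" by (cases u) auto
    then have j: "j \<in> {1..n}" using u sub by auto
    then have "k j \<le> K" unfolding K_def by (intro Max_ge) auto
    have "(w @ [j]) @ take (k j) u' \<in> T"
      by (rule prefix[of _ "drop (k j) u'"]) (use u ju in simp)
    then show False using k[OF j, of "take (k j) u'"] \<open>k j \<le> K\<close> ju by simp
  qed
  have "Q []" using long by (auto simp: Q_def)
  then have "\<exists>p. \<forall>i. Q (p i) \<and> (\<exists>j\<in>{1..n}. p (Suc i) = p i @ [j])"
    using extend by (intro dependent_nat_choice) blast+
  then obtain p where p: "\<And>i. Q (p i)" "\<And>i. \<exists>j\<in>{1..n}. p (Suc i) = p i @ [j]" by blast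
  have "p i \<in> T \<and> (p i, p (Suc i)) \<in> edges n" for i
    using Q_T[OF p(1)[of i]] p(2)[of i] sub by (auto simp: edges_def)
  then show ?thesis by blast
qed

text \<open>Labels above \<open>v\<close> can only add to the cover provided by the labels from \<open>v\<close> on.\<close>

lemma covered_if_load:
  assumes "v \<in> verts n" "w \<in> verts n" "1 \<le> load Y v 0 w"
  shows "v @ w \<in> covered n Y"
proof -
  obtain i where i: "i \<le> length w" "1 + (length w - i) \<le> Y (v @ take i w)"
    using assms(3) le_load_iff[of 1 Y v 0 w] by auto
  then have "length (v @ w) - (length v + i) < Y (take (length v + i) (v @ w))" by simp
  then show ?thesis using assms i unfolding covered_iff by (auto intro!: exI[of _ "length v + i"])
qed

lemma all_le_Suc_iff: "(\<forall>i\<le>Suc k. P i) \<longleftrightarrow> P 0 \<and> (\<forall>i\<le>k. P (Suc i))"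
proof
  assume *: "P 0 \<and> (\<forall>i\<le>k. P (Suc i))"
  show "\<forall>i\<le>Suc k. P i"
  proof (intro allI impI)
    fix i assume "i \<le> Suc k"
    then show "P i" using * by (cases i) auto
  qed
qed auto

text \<open>With inherited cover \<open>c\<close> at \<open>v\<close>, some path from \<open>v\<close> down to depth \<open>k\<close> is covered and has all its
labels in \<open>S\<close>.\<close>

definition alive :: "nat \<Rightarrow> nat set \<Rightarrow> (nat list \<Rightarrow> nat) \<Rightarrow> nat \<Rightarrow> nat \<Rightarrow> nat list \<Rightarrow> bool" where
  "alive n S = pass n (\<lambda>h c y. y \<in> S \<and> 1 \<le> max c y) (\<lambda>h c y. max c y - 1)"

text \<open>The recursive exploration of the tree and the individuals of the branching process describe the
same event.\<close>

lemma alive_iff: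
  "alive n S Y k c v \<longleftrightarrow>
     (\<exists>w\<in>verts n. length w = k \<and> (\<forall>i\<le>k. 1 \<le> load Y v c (take i w) \<and> Y (v @ take i w) \<in> S))"
proof (induction k arbitrary: c v)
  case 0
  show ?case by (auto simp: alive_def)
next
  case (Suc k)
  let ?good = "\<lambda>k c v w. \<forall>i\<le>k. 1 \<le> load Y v c (take i w) \<and> Y (v @ take i w) \<in> S"
  have good_Cons: "?good (Suc k) c v (j # w) \<longleftrightarrow>
      Y v \<in> S \<and> 1 \<le> max c (Y v) \<and> ?good k (max c (Y v) - 1) (v @ [j]) w" for j w
    unfolding all_le_Suc_iff[of k] by auto
  have "alive n S Y (Suc k) c v \<longleftrightarrow> Y v \<in> S \<and> 1 \<le> max c (Y v) \<and>
      (\<exists>j\<in>{1..n}. alive n S Y k (max c (Y v) - 1) (v @ [j]))"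
    by (simp add: alive_def)
  also have "\<dots> \<longleftrightarrow> (\<exists>j\<in>{1..n}. \<exists>w\<in>verts n. length w = k \<and> ?good (Suc k) c v (j # w))"
    unfolding Suc.IH good_Cons by blast
  also have "\<dots> \<longleftrightarrow> (\<exists>w\<in>verts n. length w = Suc k \<and> ?good (Suc k) c v w)"
  proof
    assume "\<exists>j\<in>{1..n}. \<exists>w\<in>verts n. length w = k \<and> ?good (Suc k) c v (j # w)"
    then obtain j w where "j \<in> {1..n}" "w \<in> verts n" "length w = k" "?good (Suc k) c v (j # w)" by blast
    then show "\<exists>w\<in>verts n. length w = Suc k \<and> ?good (Suc k) c v w"
      by (intro bexI[of _ "j # w"]) auto
  next
    assume "\<exists>w\<in>verts n. length w = Suc k \<and> ?good (Suc k) c v w"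
    then obtain w where w: "w \<in> verts n" "length w = Suc k" "?good (Suc k) c v w" by blast
    then obtain j w' where "w = j # w'" by (cases w) auto
    then show "\<exists>j\<in>{1..n}. \<exists>w\<in>verts n. length w = k \<and> ?good (Suc k) c v (j # w)"
      using w by (intro bexI[of _ j] bexI[of _ w']) auto
  qed
  finally show ?case .
qed

lemma alive_antimono:
  assumes "alive n S Y k c v" "l \<le> k"
  shows "alive n S Y l c v"
proof -
  obtain w where w: "w \<in> verts n" "length w = k"
    "\<And>i. i \<le> k \<Longrightarrow> 1 \<le> load Y v c (take i w) \<and> Y (v @ take i w) \<in> S"
    using assms(1) unfolding alive_iff by blast
  then show ?thesis unfolding alive_iff using assms(2)
    by (intro bexI[of _ "take l w"]) (auto simp: take_in_verts min_absorb1 min_absorb2)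
qed

lemma individuals_nonempty_iff: "individuals n Y k \<noteq> {} \<longleftrightarrow> alive n UNIV Y k 0 []"
  unfolding alive_iff using individuals_iff_load[of _ n Y k] by auto

lemma infinite_path_if_alive:
  assumes v: "v \<in> verts n" and al: "\<And>k. alive n UNIV Y k 0 v"
  shows "contains_infinite_path n (covered n Y)"
proof -
  define T where "T = {w \<in> verts n. \<forall>i\<le>length w. 1 \<le> load Y v 0 (take i w)}"
  have "\<exists>p. \<forall>i. p i \<in> T \<and> (p i, p (Suc i)) \<in> edges n"
  proof (rule koenig_words)
    show "w \<in> T" if "w @ [j] \<in> T" for w j
    proof -
      have "1 \<le> load Y v 0 (take i w)" if "i \<le> length w" for i
      proof -
        have "\<forall>i\<le>length (w @ [j]). 1 \<le> load Y v 0 (take i (w @ [j]))"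
          using \<open>w @ [j] \<in> T\<close> unfolding T_def by blast
        moreover have "i \<le> length (w @ [j])" using that by simp
        ultimately have "1 \<le> load Y v 0 (take i (w @ [j]))" by blast
        then show ?thesis using that by simp
      qed
      then show ?thesis using that by (auto simp: T_def)
    qed
    show "\<exists>w\<in>T. length w = k" for k using al[of k] unfolding alive_iff T_def by auto
  qed (auto simp: T_def)
  then obtain p where p: "\<And>i. p i \<in> T" "\<And>i. (p i, p (Suc i)) \<in> edges n" by blast
  have "v @ p i \<in> covered n Y \<and> (v @ p i, v @ p (Suc i)) \<in> edges n" for i
  proof
    have "p i \<in> verts n" "1 \<le> load Y v 0 (take (length (p i)) (p i))"
      using p(1)[of i] unfolding T_def by blast+
    then show "v @ p i \<in> covered n Y" using covered_if_load[OF v] by simp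
    show "(v @ p i, v @ p (Suc i)) \<in> edges n" using p(2)[of i] v by (auto simp: edges_def)
  qed
  then show ?thesis unfolding contains_infinite_path_def by (intro exI[of _ "\<lambda>i. v @ p i"]) blast
qed

text \<open>The cover \<open>c\<close> inherited by the first vertex of the path comes from a label above it, which is
strictly larger than \<open>c\<close>.\<close>

lemma alive_if_infinite_path:
  assumes "contains_infinite_path n (covered n Y)"
  obtains v c where "v \<in> verts n" "\<And>k. alive n UNIV Y k c v"
    "c = 0 \<or> (\<exists>x\<in>verts n. c < Y x)"
proof -
  obtain p where p: "\<And>i. p i \<in> covered n Y" "\<And>i. (p i, p (Suc i)) \<in> edges n"
    using assms by (auto simp: contains_infinite_path_def)
  define v where "v = p 0"
  have v: "v \<in> verts n" using p(1)[of 0] by (simp add: v_def covered_iff)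
  have "\<exists>w\<in>verts n. length w = i \<and> p i = v @ w \<and> (\<forall>l\<le>i. p l = v @ take l w)" for i
  proof (induction i)
    case (Suc i)
    then obtain w where w: "w \<in> verts n" "length w = i" "p i = v @ w" "\<forall>l\<le>i. p l = v @ take l w"
      by blast
    obtain j where "j \<in> {1..n}" "p (Suc i) = p i @ [j]" using p(2)[of i] by (auto simp: edges_def)
    then show ?case using w by (intro bexI[of _ "w @ [j]"]) (auto simp: le_Suc_eq)
  qed (simp add: v_def)
  then have ray: "\<exists>w\<in>verts n. length w = i \<and> (\<forall>l\<le>i. v @ take l w \<in> covered n Y)" for i
    using p(1) by metis
  define c where "c = (if v = [] then 0 else load Y [] 0 (butlast v) - 1)"
  have load_eq: "load Y [] 0 (v @ w) = load Y v c w" for w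
  proof (cases v rule: rev_cases)
    case (snoc u j)
    then show ?thesis using load_append[of Y "[]" 0 u j w] by (simp add: c_def)
  qed (simp add: c_def)
  have "alive n UNIV Y k c v" for k
  proof -
    obtain w where w: "w \<in> verts n" "length w = k" "\<And>l. l \<le> k \<Longrightarrow> v @ take l w \<in> covered n Y"
      using ray by blast
    then show ?thesis unfolding alive_iff
      by (intro bexI[of _ w]) (auto simp: covered_iff_load load_eq)
  qed
  moreover have "c = 0 \<or> (\<exists>x\<in>verts n. c < Y x)"
  proof (cases "c = 0")
    case False
    let ?u = "butlast v"
    have "1 \<le> Suc c" "Suc c \<le> load Y [] 0 ?u" using False by (auto simp: c_def split: if_splits)
    then obtain i where "i \<le> length ?u" "Suc c + (length ?u - i) \<le> Y ([] @ take i ?u)"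
      using le_load_iff[of "Suc c" Y "[]" 0 ?u] by auto
    moreover have "take i ?u \<in> verts n"
      using v by (auto simp: take_in_verts verts_def dest: in_set_butlastD in_set_takeD)
    ultimately show ?thesis by (intro disjI2 bexI[of _ "take i ?u"]) auto
  qed simp
  ultimately show ?thesis using v that by blast
qed

text \<open>The vertex \<open>y\<close> is an individual of type \<open>z\<close>.\<close>

definition lineage :: "nat \<Rightarrow> (nat list \<Rightarrow> nat) \<Rightarrow> nat \<Rightarrow> nat list \<Rightarrow> bool" where
  "lineage n Y z y \<longleftrightarrow> (\<forall>i\<le>length y. 1 \<le> load Y [] 0 (take i y)) \<and> load Y [] 0 y = z"

lemma finite_iff_bounded_length:
  assumes "A \<subseteq> verts n"
  shows "finite A \<longleftrightarrow> (\<exists>m. \<forall>y\<in>A. length y < m)"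
proof
  assume "finite A"
  then have "finite (length ` A)" by simp
  then obtain m where "length ` A \<subseteq> {..<m}" using finite_nat_iff_bounded by blast
  then show "\<exists>m. \<forall>y\<in>A. length y < m" by blast
next
  assume "\<exists>m. \<forall>y\<in>A. length y < m"
  then obtain m where "A \<subseteq> {y \<in> verts n. length y < m}" using assms by blast
  then show "finite A" using finite_levels_below finite_subset by blast
qed

lemma individuals_of_type:
  "{y \<in> (\<Union>m. individuals n Y m). ind_type n Y y = int z} = {y \<in> verts n. lineage n Y z y}"
proof -
  have "y \<in> (\<Union>m. individuals n Y m) \<longleftrightarrow> y \<in> verts n \<and> (\<forall>i\<le>length y. 1 \<le> load Y [] 0 (take i y))" for y
    by (auto simp: individuals_iff_load)
  moreover have "ind_type n Y y = int z \<longleftrightarrow> load Y [] 0 y = z"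
    if "y \<in> verts n" "\<forall>i\<le>length y. 1 \<le> load Y [] 0 (take i y)" for y
  proof -
    have "1 \<le> load Y [] 0 (take (length y) y)" using that(2) by blast
    then show ?thesis using ind_type_eq_load[OF that(1), of Y] by simp
  qed
  ultimately show ?thesis unfolding lineage_def by blast
qed

lemma dies_out_locally_iff:
  "dies_out_locally n \<mu> Y \<longleftrightarrow>
     (\<forall>z\<in>types \<mu>. \<exists>m. \<forall>y\<in>verts n. lineage n Y z y \<longrightarrow> length y < m)"
proof -
  have "finite {y \<in> verts n. lineage n Y z y} \<longleftrightarrow>
      (\<exists>m. \<forall>y\<in>verts n. lineage n Y z y \<longrightarrow> length y < m)" for z
    using finite_iff_bounded_length[of "{y \<in> verts n. lineage n Y z y}" n] by auto
  then show ?thesis unfolding dies_out_locally_def individuals_of_type by blast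
qed

lemma dies_out_globally_iff: "dies_out_globally n Y \<longleftrightarrow> (\<exists>k. \<not> alive n UNIV Y k 0 [])"
  using individuals_nonempty_iff unfolding dies_out_globally_def by blast

lemma dies_out_locally_if_globally:
  assumes "dies_out_globally n Y"
  shows "dies_out_locally n \<mu> Y"
  unfolding dies_out_locally_iff
proof
  fix z
  obtain k where k: "\<not> alive n UNIV Y k 0 []" using assms by (auto simp: dies_out_globally_iff)
  have "length y < k" if "y \<in> verts n" "lineage n Y z y" for y
  proof (rule ccontr)
    assume "\<not> length y < k"
    moreover have "alive n UNIV Y (length y) 0 []"
      unfolding alive_iff using that by (auto simp: lineage_def)
    ultimately show False using alive_antimono[of n UNIV Y "length y" 0 "[]" k] k by simp
  qed
  then show "\<exists>m. \<forall>y\<in>verts n. lineage n Y z y \<longrightarrow> length y < m" by blast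
qed

text \<open>If each type \<open>z \<le> N\<close> had its last individual before level \<open>m z\<close>, a truncated lineage that reaches
the maximum of these finitely many levels would end in an individual without admissible type.\<close>

lemma not_dies_out_locally_if_truncated_alive:
  assumes N: "N \<in> types \<mu>" and al: "\<And>k. alive n {..N} Y k 0 []"
  shows "\<not> dies_out_locally n \<mu> Y"
proof
  assume "dies_out_locally n \<mu> Y"
  moreover have sub: "{1..N} \<subseteq> types \<mu>" using atMost_types[OF N] by auto
  ultimately have "\<forall>z\<in>{1..N}. \<exists>m. \<forall>y\<in>verts n. lineage n Y z y \<longrightarrow> length y < m"
    unfolding dies_out_locally_iff by blast
  then obtain m where m: "\<And>z y. z \<in> {1..N} \<Longrightarrow> y \<in> verts n \<Longrightarrow> lineage n Y z y \<Longrightarrow> length y < m z"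
    by metis
  define K where "K = Max (insert 0 (m ` {1..N}))"
  obtain w where w: "w \<in> verts n" "length w = K"
    "\<And>i. i \<le> K \<Longrightarrow> 1 \<le> load Y [] 0 (take i w) \<and> Y (take i w) \<le> N"
    using al[of K] unfolding alive_iff by auto
  define z where "z = load Y [] 0 w"
  have "lineage n Y z w" using w by (auto simp: lineage_def z_def)
  moreover have z: "z \<in> {1..N}"
  proof -
    have "1 \<le> z" using w(3)[of K] w(2) by (simp add: z_def)
    moreover have "\<not> Suc N \<le> z"
    proof
      assume "Suc N \<le> z"
      then obtain i where "i \<le> K" "Suc N + (K - i) \<le> Y (take i w)"
        using le_load_iff[of "Suc N" Y "[]" 0 w] w(2) by (auto simp: z_def)
      moreover have "Y (take i w) \<le> N" using w(3)[of i] \<open>i \<le> K\<close> by blast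
      ultimately show False by linarith
    qed
    ultimately show ?thesis by simp
  qed
  ultimately have "K < m z" using m w by blast
  moreover have "m z \<le> K" unfolding K_def using z by (intro Max_ge) auto
  ultimately show False by simp
qed

lemma survival_eq_pass_prob:
  "survival \<mu> S n k c =
     pass_prob \<mu> n (\<lambda>h c y. y \<in> S \<and> 1 \<le> max c y) (\<lambda>h c y. max c y - 1) k c"
proof (induction k arbitrary: c)
  case 0
  have "transfer \<mu> S (\<lambda>c. 1) c = measure_pmf.expectation \<mu> (indicator {y. y \<in> S \<and> 1 \<le> max c y})"
    unfolding transfer_def
    by (rule arg_cong[where f="measure_pmf.expectation \<mu>"]) (auto simp: indicator_def)
  then show ?case by simp
next
  case (Suc k)
  show ?case unfolding survival.simps transfer_def pass_prob.simps Suc.IH ..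
qed

text \<open>Together with \<open>reset_step\<close>, this describes the existence of a vertex at height \<open>k\<close> whose subtree
survives to its full depth \<open>k\<close> without inherited cover: above height \<open>k\<close> every label is accepted and
the inherited cover is forgotten.\<close>

definition reset_ok :: "nat \<Rightarrow> nat \<Rightarrow> nat \<Rightarrow> nat \<Rightarrow> bool" where
  "reset_ok k h c y \<longleftrightarrow> (h \<le> k \<longrightarrow> 1 \<le> max c y)"

definition reset_step :: "nat \<Rightarrow> nat \<Rightarrow> nat \<Rightarrow> nat \<Rightarrow> nat" where
  "reset_step k h c y = (if k < h then 0 else max c y - 1)"

lemma reset_simps:
  "h \<le> k \<Longrightarrow> reset_ok k h c y \<longleftrightarrow> 1 \<le> max c y" "k < h \<Longrightarrow> reset_ok k h c y"
  "h \<le> k \<Longrightarrow> reset_step k h c y = max c y - 1" "k < h \<Longrightarrow> reset_step k h c y = 0"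
  by (auto simp: reset_ok_def reset_step_def)

lemma alive_if_pass_reset:
  "pass n (reset_ok k) (reset_step k) Y (k + m) 0 v \<Longrightarrow>
     \<exists>w\<in>verts n. length w = m \<and> alive n UNIV Y k 0 (v @ w)"
proof (induction m arbitrary: v)
  case 0
  have "pass n (reset_ok k) (reset_step k) Y h c v = alive n UNIV Y h c v" if "h \<le> k" for h c v
    using that
  proof (induction h arbitrary: c v)
    case (Suc h)
    then show ?case by (simp add: alive_def reset_simps)
  qed (simp add: alive_def reset_simps)
  then show ?case using 0 by simp
next
  case (Suc m)
  then obtain j where "j \<in> {1..n}" "pass n (reset_ok k) (reset_step k) Y (k + m) 0 (v @ [j])"
    by (auto simp: reset_simps)
  then obtain w where "w \<in> verts n" "length w = m" "alive n UNIV Y k 0 ((v @ [j]) @ w)"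
    using Suc.IH by blast
  then show ?case using \<open>j \<in> {1..n}\<close> by (intro bexI[of _ "j # w"]) auto
qed

text \<open>The \<open>n\<^sup>m\<close> subtrees at level \<open>m\<close> are independent copies of each other.\<close>

lemma pass_prob_reset:
  "pass_prob \<mu> n (reset_ok k) (reset_step k) (k + m) 0 = 1 - (1 - survival \<mu> UNIV n k 0) ^ (n ^ m)"
proof (induction m)
  case 0
  have "pass_prob \<mu> n (reset_ok k) (reset_step k) h c = survival \<mu> UNIV n h c" if "h \<le> k" for h c
    using that
  proof (induction h arbitrary: c)
    case 0
    then show ?case by (simp only: survival_eq_pass_prob) (simp add: reset_ok_def[abs_def])
  next
    case (Suc h)
    then have "\<not> k < Suc h" "h \<le> k" by auto
    then show ?case using Suc.IH Suc.prems
      by (simp add: transfer_def reset_simps cong: if_cong)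
  qed
  then show ?case by simp
next
  case (Suc m)
  have "pass_prob \<mu> n (reset_ok k) (reset_step k) (k + Suc m) 0 =
      1 - (1 - pass_prob \<mu> n (reset_ok k) (reset_step k) (k + m) 0) ^ n"
    by (simp add: reset_simps)
  then show ?case by (simp add: Suc.IH power_mult[symmetric] mult.commute)
qed

lemma uncovered_if_pass:
  assumes "pass n (\<lambda>h c y. y \<le> h) (\<lambda>h c y. 0) Y h c v"
  shows "\<exists>w\<in>verts n. length w = h \<and> (\<forall>i\<le>h. Y (v @ take i w) \<le> h - i)"
  using assms
proof (induction h arbitrary: c v)
  case 0
  then show ?case by (intro bexI[of _ "[]"]) auto
next
  case (Suc h)
  then obtain j where j: "j \<in> {1..n}" "pass n (\<lambda>h c y. y \<le> h) (\<lambda>h c y. 0) Y h 0 (v @ [j])"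
    and Yv: "Y v \<le> Suc h" by auto
  then obtain w where w: "w \<in> verts n" "length w = h" "\<forall>i\<le>h. Y ((v @ [j]) @ take i w) \<le> h - i"
    using Suc.IH by blast
  have "Y (v @ take i (j # w)) \<le> Suc h - i" if "i \<le> Suc h" for i
    using w(3) Yv that by (cases i) auto
  then show ?case using w j by (intro bexI[of _ "j # w"]) auto
qed

section \<open>Uncovered vertices on deep levels\<close>

text \<open>After \<open>j\<close> steps beyond a late index, the initial value has been damped by \<open>r\<^sup>j\<close> and the accumulated
errors form a geometric series that is as small as desired.\<close>

lemma contraction_with_vanishing_error:
  fixes x e :: "nat \<Rightarrow> real"
  assumes r: "0 \<le> r" "r < 1" and x: "\<And>i. 0 \<le> x i" and e: "e \<longlonglongrightarrow> 0"
    and step: "\<And>i. i0 \<le> i \<Longrightarrow> x (Suc i) \<le> r * x i + e i"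
  shows "x \<longlonglongrightarrow> 0"
proof (rule LIMSEQ_I)
  fix \<eta> :: real assume \<eta>: "0 < \<eta>"
  have "eventually (\<lambda>i. e i < \<eta> / 2 * (1 - r)) sequentially"
    using e r \<eta> by (intro order_tendstoD(2)[OF e]) simp
  then obtain i1 where i1: "\<And>i. i1 \<le> i \<Longrightarrow> e i < \<eta> / 2 * (1 - r)"
    by (auto simp: eventually_sequentially)
  define i2 where "i2 = max i0 i1"
  have bound: "x (i2 + j) \<le> r ^ j * x i2 + \<eta> / 2" for j
  proof (induction j)
    case (Suc j)
    have "x (i2 + Suc j) \<le> r * x (i2 + j) + \<eta> / 2 * (1 - r)"
    proof -
      have "i0 \<le> i2 + j" "i1 \<le> i2 + j" by (auto simp: i2_def)
      then show ?thesis using step[of "i2 + j"] i1[of "i2 + j"] by simp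
    qed
    also have "\<dots> \<le> r * (r ^ j * x i2 + \<eta> / 2) + \<eta> / 2 * (1 - r)"
      using mult_left_mono[OF Suc.IH r(1)] by simp
    also have "\<dots> = r ^ Suc j * x i2 + \<eta> / 2" by (simp add: field_simps)
    finally show ?case .
  qed (use \<eta> in simp)
  have "(\<lambda>j. r ^ j * x i2) \<longlonglongrightarrow> 0 * x i2"
    using r by (intro tendsto_intros LIMSEQ_power_zero) simp
  then have "eventually (\<lambda>j. r ^ j * x i2 < \<eta> / 2) sequentially"
    using \<eta> by (intro order_tendstoD(2)) auto
  then obtain j1 where j1: "\<And>j. j1 \<le> j \<Longrightarrow> r ^ j * x i2 < \<eta> / 2"
    by (auto simp: eventually_sequentially)
  have "norm (x i - 0) < \<eta>" if "i2 + j1 \<le> i" for i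
  proof -
    have "i2 + (i - i2) = i" "j1 \<le> i - i2" using that by auto
    then have "x i < \<eta>" using bound[of "i - i2"] j1[of "i - i2"] by simp
    then show ?thesis using x[of i] by simp
  qed
  then show "\<exists>no. \<forall>i\<ge>no. norm (x i - 0) < \<eta>" by blast
qed

text \<open>The recursion is that of a path from height \<open>i\<close> down to height \<open>0\<close> in which a vertex at height
\<open>i\<close> is open with probability \<open>F i\<close>. First \<open>\<theta>\<close> is kept away from \<open>0\<close>: once \<open>F > 3/4\<close>, the map
\<open>t \<mapsto> 3/4 (1 - (1 - t)\<^sup>2)\<close> does not decrease values below \<open>2/3\<close>. Then \<open>1 - \<theta>\<close> contracts by a factor
\<open>1 - \<delta>\<close> up to the error \<open>1 - F\<close>.\<close>

lemma open_path_prob_tendsto_1: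
  fixes F \<theta> :: "nat \<Rightarrow> real"
  assumes n: "2 \<le> n" and F: "\<And>i. 0 < F i" "\<And>i. F i \<le> 1" "F \<longlonglongrightarrow> 1"
    and \<theta>0: "0 < \<theta> 0" "\<theta> 0 \<le> 1" and \<theta>_Suc: "\<And>i. \<theta> (Suc i) = F (Suc i) * (1 - (1 - \<theta> i) ^ n)"
  shows "\<theta> \<longlonglongrightarrow> 1"
proof -
  have unit: "0 < \<theta> i \<and> \<theta> i \<le> 1" for i
  proof (induction i)
    case (Suc i)
    have "(1 - \<theta> i) ^ n < 1" using Suc.IH n by (intro power_less_one_iff[THEN iffD2]) auto
    moreover have "0 \<le> (1 - \<theta> i) ^ n" using Suc.IH by simp
    ultimately show ?case using F(1,2)[of "Suc i"] by (auto simp: \<theta>_Suc intro!: mult_le_one)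
  qed (use \<theta>0 in auto)
  have pow: "(1 - \<theta> i) ^ n \<le> (1 - \<theta> i)\<^sup>2" for i
    using n unit[of i] by (intro power_decreasing) auto
  have "eventually (\<lambda>i. 3 / 4 < F i) sequentially"
    by (rule order_tendstoD(1)[OF F(3)]) simp
  then obtain i0 where i0: "\<And>i. i0 \<le> i \<Longrightarrow> 3 / 4 < F i"
    by (auto simp: eventually_sequentially)
  define \<delta> where "\<delta> = min (\<theta> i0) (2 / 3)"
  have \<delta>: "0 < \<delta>" "\<delta> \<le> 2 / 3" using unit[of i0] by (auto simp: \<delta>_def)
  have lower: "\<delta> \<le> \<theta> i" if "i0 \<le> i" for i
    using that
  proof (induction i rule: dec_induct)
    case (step i)
    have "\<delta> \<le> 3 / 4 * (1 - (1 - \<delta>)\<^sup>2)"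
    proof -
      have "0 \<le> \<delta> * (2 / 3 - \<delta>)" using \<delta> by simp
      then show ?thesis by (simp add: power2_eq_square algebra_simps)
    qed
    also have "\<dots> \<le> 3 / 4 * (1 - (1 - \<theta> i) ^ n)"
    proof -
      have "(1 - \<theta> i)\<^sup>2 \<le> (1 - \<delta>)\<^sup>2" using step.IH unit[of i] by (intro power_mono) auto
      then show ?thesis using pow[of i] by simp
    qed
    also have "\<dots> \<le> \<theta> (Suc i)"
      unfolding \<theta>_Suc using i0[of "Suc i"] step.hyps unit[of i]
      by (intro mult_right_mono) (auto intro!: power_le_one)
    finally show ?case .
  qed (simp add: \<delta>_def)
  have "(\<lambda>i. 1 - \<theta> i) \<longlonglongrightarrow> 0"
  proof (rule contraction_with_vanishing_error[where r = "1 - \<delta>" and e = "\<lambda>i. 1 - F (Suc i)"])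
    show "(\<lambda>i. 1 - F (Suc i)) \<longlonglongrightarrow> 0"
      using tendsto_diff[OF tendsto_const[of 1] LIMSEQ_Suc[OF F(3)]] by simp
    fix i assume i: "i0 \<le> i"
    have "1 - \<theta> (Suc i) = (1 - F (Suc i)) + F (Suc i) * (1 - \<theta> i) ^ n"
      by (simp add: \<theta>_Suc algebra_simps)
    also have "F (Suc i) * (1 - \<theta> i) ^ n \<le> 1 * (1 - \<theta> i) ^ n"
      using F(2)[of "Suc i"] unit[of i] by (intro mult_right_mono) auto
    also have "1 * (1 - \<theta> i) ^ n \<le> (1 - \<delta>) * (1 - \<theta> i)"
      using pow[of i] mult_right_mono[of "1 - \<theta> i" "1 - \<delta>" "1 - \<theta> i"] lower[OF i] unit[of i]
      by (simp add: power2_eq_square)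
    finally show "1 - \<theta> (Suc i) \<le> (1 - \<delta>) * (1 - \<theta> i) + (1 - F (Suc i))" by simp
  qed (use \<delta> unit in auto)
  from tendsto_diff[OF tendsto_const[of 1] this] show ?thesis by simp
qed

section \<open>Percolation\<close>

locale percolation = labelled_tree M n \<mu> Y + label_law \<mu>
  for M :: "'a measure" and n :: nat and \<mu> :: "nat pmf" and Y :: "nat list \<Rightarrow> 'a \<Rightarrow> nat" +
  assumes two_le_n: "2 \<le> n"
begin

lemma measurable_alive: "v \<in> verts n \<Longrightarrow> Measurable.pred M (\<lambda>\<omega>. alive n S (lab \<omega>) k c v)"
  unfolding alive_def by (rule measurable_pass_lab)

lemma prob_alive:
  "v \<in> verts n \<Longrightarrow> prob {\<omega> \<in> space M. alive n S (lab \<omega>) k c v} = survival \<mu> S n k c"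
  unfolding alive_def survival_eq_pass_prob by (rule prob_pass)

lemma measurable_always_alive:
  assumes "v \<in> verts n"
  shows "Measurable.pred M (\<lambda>\<omega>. \<forall>k. alive n S (lab \<omega>) k c v)"
  using measurable_alive[OF assms] by (rule pred_intros_countable)

lemma prob_always_alive_le:
  assumes v: "v \<in> verts n"
  shows "prob {\<omega> \<in> space M. \<forall>k. alive n S (lab \<omega>) k c v} \<le> survival \<mu> S n k c"
  unfolding prob_alive[OF v, symmetric]
  by (rule finite_measure_mono[OF _ predE[OF measurable_alive[OF v]]]) blast

lemma le_prob_all:
  assumes meas: "\<And>k. Measurable.pred M (E k)"
    and dec: "\<And>k \<omega>. E (Suc k) \<omega> \<Longrightarrow> E k \<omega>" and ge: "\<And>k. \<epsilon> \<le> prob {\<omega> \<in> space M. E k \<omega>}"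
  shows "\<epsilon> \<le> prob {\<omega> \<in> space M. \<forall>k. E k \<omega>}"
proof (rule LIMSEQ_le_const)
  have "(\<lambda>k. prob {\<omega> \<in> space M. E k \<omega>}) \<longlonglongrightarrow> prob (\<Inter>k. {\<omega> \<in> space M. E k \<omega>})"
    using meas dec by (intro finite_Lim_measure_decseq) (auto intro!: decseq_SucI)
  moreover have "(\<Inter>k. {\<omega> \<in> space M. E k \<omega>}) = {\<omega> \<in> space M. \<forall>k. E k \<omega>}" by auto
  ultimately show "(\<lambda>k. prob {\<omega> \<in> space M. E k \<omega>}) \<longlonglongrightarrow> prob {\<omega> \<in> space M. \<forall>k. E k \<omega>}" by simp
qed (use ge in blast)

lemma le_prob_always_alive:
  assumes v: "v \<in> verts n" and "\<And>k. \<epsilon> \<le> survival \<mu> S n k c"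
  shows "\<epsilon> \<le> prob {\<omega> \<in> space M. \<forall>k. alive n S (lab \<omega>) k c v}"
  by (rule le_prob_all)
     (use assms in \<open>auto simp: prob_alive intro: measurable_alive alive_antimono\<close>)

lemma AE_not_if_prob_le_0:
  assumes meas: "Measurable.pred M E" and "prob {\<omega> \<in> space M. E \<omega>} \<le> 0"
  shows "AE \<omega> in M. \<not> E \<omega>"
proof -
  have "prob {\<omega> \<in> space M. E \<omega>} = 0" using assms(2) by (simp add: measure_le_0_iff)
  then have "AE \<omega> in M. \<omega> \<notin> {\<omega> \<in> space M. E \<omega>}" using prob_eq_0[OF predE[OF meas]] by blast
  with AE_space show ?thesis by eventually_elim blast
qed

text \<open>Level \<open>h\<close> contains an uncovered vertex with probability tending to \<open>1\<close>, so almost surely infinitely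
many levels do.\<close>

lemma AE_infinite_uncovered: "AE \<omega> in M. infinite (uncovered n (lab \<omega>))"
proof -
  let ?ok = "\<lambda>h c y :: nat. y \<le> h" and ?st = "\<lambda>h c y :: nat. 0 :: nat"
  define \<theta> where "\<theta> h = pass_prob \<mu> n ?ok ?st h 0" for h
  define F where "F h = measure_pmf.prob \<mu> {..h}" for h
  let ?E = "\<lambda>h \<omega>. pass n ?ok ?st (lab \<omega>) h 0 []"
  have meas: "Measurable.pred M (?E h)" for h by (rule measurable_pass_lab) simp
  have prob_E: "prob {\<omega> \<in> space M. ?E h \<omega>} = \<theta> h" for h
    unfolding \<theta>_def by (rule prob_pass) simp
  have "\<theta> \<longlonglongrightarrow> 1"
  proof (rule open_path_prob_tendsto_1[OF two_le_n])
    have F0: "pmf \<mu> 0 \<le> F h" for h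
      unfolding F_def measure_pmf_single[symmetric] by (intro measure_pmf.finite_measure_mono) auto
    show "0 < F h" for h using F0[of h] pmf_0_pos by simp
    show "F h \<le> 1" for h by (simp add: F_def)
    have "F \<longlonglongrightarrow> measure_pmf.prob \<mu> (\<Union>h. {..h})"
      unfolding F_def by (rule measure_pmf.finite_Lim_measure_incseq) (auto simp: incseq_def)
    moreover have "(\<Union>h. {..h}) = (UNIV :: nat set)" by auto
    ultimately show "F \<longlonglongrightarrow> 1" by simp
    have "\<theta> 0 = F 0" by (simp add: \<theta>_def F_def atMost_def)
    then show "0 < \<theta> 0" "\<theta> 0 \<le> 1" using F0[of 0] pmf_0_pos by (auto simp: F_def)
    show "\<theta> (Suc h) = F (Suc h) * (1 - (1 - \<theta> h) ^ n)" for h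
    proof -
      have "\<theta> (Suc h) =
          measure_pmf.expectation \<mu> (\<lambda>y. indicator {..Suc h} y * (1 - (1 - \<theta> h) ^ n))"
        unfolding \<theta>_def pass_prob.simps
        by (rule arg_cong[where f="measure_pmf.expectation \<mu>"]) (auto simp: indicator_def)
      then show ?thesis by (simp add: F_def)
    qed
  qed
  then have lim: "(\<lambda>h. 1 - \<theta> h) \<longlonglongrightarrow> 0"
    using tendsto_diff[OF tendsto_const[of 1], of \<theta> 1] by simp
  have "AE \<omega> in M. \<exists>h\<ge>h0. ?E h \<omega>" for h0
  proof -
    let ?N = "{\<omega> \<in> space M. \<forall>h\<in>{h0..}. \<not> ?E h \<omega>}"
    have N: "Measurable.pred M (\<lambda>\<omega>. \<forall>h\<in>{h0..}. \<not> ?E h \<omega>)"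
      by (intro pred_intros_countable_bounded pred_intros_logic meas)
    have "prob ?N \<le> 1 - \<theta> h" if "h0 \<le> h" for h
    proof -
      have "prob ?N \<le> prob {\<omega> \<in> space M. \<not> ?E h \<omega>}"
        using that by (intro finite_measure_mono predE pred_intros_logic meas) auto
      also have "\<dots> = 1 - \<theta> h"
        using prob_neg[OF predE[OF meas]] prob_E by simp
      finally show ?thesis .
    qed
    then have "prob ?N \<le> 0" using LIMSEQ_le_const[OF lim] by blast
    then have "AE \<omega> in M. \<not> (\<forall>h\<in>{h0..}. \<not> ?E h \<omega>)" by (rule AE_not_if_prob_le_0[OF N])
    then show ?thesis by (rule eventually_mono) auto
  qed
  then have "AE \<omega> in M. \<forall>h0. \<exists>h\<ge>h0. ?E h \<omega>" by (simp add: AE_all_countable)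
  then show ?thesis
  proof (rule eventually_mono)
    fix \<omega> assume E: "\<forall>h0. \<exists>h\<ge>h0. ?E h \<omega>"
    show "infinite (uncovered n (lab \<omega>))"
    proof
      assume "finite (uncovered n (lab \<omega>))"
      then obtain m where m: "\<And>w. w \<in> uncovered n (lab \<omega>) \<Longrightarrow> length w < m"
        using finite_iff_bounded_length[of "uncovered n (lab \<omega>)" n] by (auto simp: uncovered_def)
      obtain h where "h \<ge> m" "?E h \<omega>" using E by blast
      then obtain w where w: "w \<in> verts n" "length w = h" "\<forall>i\<le>h. Y (take i w) \<omega> \<le> h - i"
        using uncovered_if_pass[of n "lab \<omega>" h 0 "[]"] by auto
      then have "w \<in> uncovered n (lab \<omega>)" by (auto simp: uncovered_def covered_iff not_less)
      then show False using m[of w] w \<open>h \<ge> m\<close> by simp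
    qed
  qed
qed

lemma measure_survives_globally:
  "measure M {\<omega> \<in> space M. \<not> dies_out_globally n (lab \<omega>)} =
   prob {\<omega> \<in> space M. \<forall>k. alive n UNIV (lab \<omega>) k 0 []}"
  by (simp add: dies_out_globally_iff)

text \<open>The survival probability is a lower bound for all finite-depth probabilities, one of which is
smaller than any given positive number outside the supercritical case.\<close>

lemma supercritical_if_survives_globally:
  assumes "0 < prob {\<omega> \<in> space M. \<not> dies_out_globally n (lab \<omega>)}"
  shows "supercritical \<mu> UNIV n"
proof (rule ccontr)
  assume "\<not> ?thesis"
  from survival_le_if_not_supercritical[OF two_le_n this assms]
  obtain k where "survival \<mu> UNIV n k 0 < prob {\<omega> \<in> space M. \<not> dies_out_globally n (lab \<omega>)}" by blast
  then show False
    using prob_always_alive_le[of "[]" UNIV 0 k] by (simp add: measure_survives_globally)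
qed

lemma measurable_load:
  assumes "u \<in> verts n" "w \<in> verts n" "c \<in> M \<rightarrow>\<^sub>M count_space UNIV"
  shows "(\<lambda>\<omega>. load (lab \<omega>) u (c \<omega>) w) \<in> M \<rightarrow>\<^sub>M count_space UNIV"
  using assms
proof (induction w arbitrary: u c)
  case Nil
  note [measurable] = measurable_label[OF Nil(1)] Nil(3)
  show ?case by simp
next
  case (Cons j w)
  note [measurable] = measurable_label[OF Cons.prems(1)] Cons.prems(3)
  show ?case unfolding load.simps by (rule Cons.IH) (use Cons.prems in \<open>auto\<close>)
qed

lemma measurable_lineage:
  assumes "y \<in> verts n"
  shows "Measurable.pred M (\<lambda>\<omega>. lineage n (lab \<omega>) z y)"
proof -
  have [measurable]: "(\<lambda>\<omega>. load (lab \<omega>) [] 0 (take i y)) \<in> M \<rightarrow>\<^sub>M count_space UNIV" for i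
    using assms by (intro measurable_load take_in_verts) auto
  have [measurable]: "(\<lambda>\<omega>. load (lab \<omega>) [] 0 y) \<in> M \<rightarrow>\<^sub>M count_space UNIV"
    using assms by (intro measurable_load) auto
  show ?thesis unfolding lineage_def by measurable
qed

lemma measurable_dies_out_locally: "Measurable.pred M (\<lambda>\<omega>. dies_out_locally n \<mu> (lab \<omega>))"
proof -
  have "Measurable.pred M (\<lambda>\<omega>. \<forall>y\<in>verts n. lineage n (lab \<omega>) z y \<longrightarrow> length y < m)" for z m
    by (intro pred_intros_countable_bounded pred_intros_logic measurable_lineage) auto
  note bounded = this
  show ?thesis
    unfolding dies_out_locally_iff
    by (rule pred_intros_countable_bounded, rule pred_intros_countable, rule bounded)
qed

lemma survives_locally_if_supercritical:
  assumes "supercritical \<mu> UNIV n"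
  shows "0 < prob {\<omega> \<in> space M. \<not> dies_out_locally n \<mu> (lab \<omega>)}"
proof -
  obtain N where N: "N \<in> types \<mu>" "supercritical \<mu> {..N} n"
    using supercritical_truncate[OF assms pmf_0_less_1] by blast
  obtain \<epsilon> where \<epsilon>: "0 < \<epsilon>" "\<And>k. \<epsilon> \<le> survival \<mu> {..N} n k 0"
    using supercritical_survival[OF N(2)] two_le_n by auto
  have "\<epsilon> \<le> prob {\<omega> \<in> space M. \<forall>k. alive n {..N} (lab \<omega>) k 0 []}"
    by (rule le_prob_always_alive) (use \<epsilon> in auto)
  also have "\<dots> \<le> prob {\<omega> \<in> space M. \<not> dies_out_locally n \<mu> (lab \<omega>)}"
    using not_dies_out_locally_if_truncated_alive[OF N(1)]
    by (intro finite_measure_mono predE pred_intros_logic measurable_dies_out_locally) auto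
  finally show ?thesis using \<epsilon>(1) by linarith
qed

lemma survives_globally_if_locally:
  assumes "0 < prob {\<omega> \<in> space M. \<not> dies_out_locally n \<mu> (lab \<omega>)}"
  shows "0 < prob {\<omega> \<in> space M. \<not> dies_out_globally n (lab \<omega>)}"
proof -
  have "Measurable.pred M (\<lambda>\<omega>. \<not> dies_out_globally n (lab \<omega>))"
    unfolding dies_out_globally_iff using measurable_always_alive[of "[]" UNIV 0] by simp
  then have "prob {\<omega> \<in> space M. \<not> dies_out_locally n \<mu> (lab \<omega>)} \<le>
      prob {\<omega> \<in> space M. \<not> dies_out_globally n (lab \<omega>)}"
    using dies_out_locally_if_globally by (intro finite_measure_mono predE) auto
  then show ?thesis using assms by linarith
qed

text \<open>At least one of \<open>n\<^sup>m\<close> independent subtrees survives forever with probability at least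
\<open>1 - (1 - \<epsilon>)\<^sup>m\<close>, for every \<open>m\<close>.\<close>

lemma AE_infinite_path_if_supercritical:
  assumes "supercritical \<mu> UNIV n"
  shows "AE \<omega> in M. contains_infinite_path n (covered n (lab \<omega>))"
proof -
  obtain \<epsilon> where \<epsilon>: "0 < \<epsilon>" "\<And>k. \<epsilon> \<le> survival \<mu> UNIV n k 0"
    using supercritical_survival[OF assms] two_le_n by auto
  have \<epsilon>1: "\<epsilon> \<le> 1" using \<epsilon>(2)[of 0] survival_bounds(2)[of \<mu> UNIV n 0 0] by linarith
  let ?G = "\<lambda>m k \<omega>. \<exists>w\<in>{w \<in> verts n. length w = m}. alive n UNIV (lab \<omega>) k 0 w"
  let ?E = "\<lambda>\<omega>. \<exists>w\<in>verts n. \<forall>k. alive n UNIV (lab \<omega>) k 0 w"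
  have meas_G: "Measurable.pred M (?G m k)" for m k
    by (intro pred_intros_finite finite_level measurable_alive) auto
  have meas_E: "Measurable.pred M ?E"
    by (intro pred_intros_countable_bounded measurable_always_alive) auto
  have G_ge: "1 - (1 - \<epsilon>) ^ (n ^ m) \<le> prob {\<omega> \<in> space M. ?G m k \<omega>}" for m k
  proof -
    have "(1 - survival \<mu> UNIV n k 0) ^ (n ^ m) \<le> (1 - \<epsilon>) ^ (n ^ m)"
      using \<epsilon>(2)[of k] survival_bounds(2)[of \<mu> UNIV n k 0] by (intro power_mono) auto
    then have "1 - (1 - \<epsilon>) ^ (n ^ m) \<le> pass_prob \<mu> n (reset_ok k) (reset_step k) (k + m) 0"
      unfolding pass_prob_reset by simp
    also have "\<dots> = prob {\<omega> \<in> space M. pass n (reset_ok k) (reset_step k) (lab \<omega>) (k + m) 0 []}"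
      by (rule prob_pass[symmetric]) simp
    also have "\<dots> \<le> prob {\<omega> \<in> space M. ?G m k \<omega>}"
    proof (intro finite_measure_mono predE meas_G Collect_mono impI conjI)
      fix \<omega> assume "\<omega> \<in> space M \<and> pass n (reset_ok k) (reset_step k) (lab \<omega>) (k + m) 0 []"
      then show "\<omega> \<in> space M" "?G m k \<omega>"
        using alive_if_pass_reset[of n k "lab \<omega>" m "[]"] by auto
    qed
    finally show ?thesis .
  qed
  \<comment> \<open>Level \<open>m\<close> is finite and survival to larger depths is harder, so one vertex serves all depths.\<close>
  have E_if_G: "?E \<omega>" if G: "\<forall>k. ?G m k \<omega>" for m \<omega>
  proof (rule ccontr)
    assume "\<not> ?E \<omega>"
    then have "\<forall>w\<in>{w \<in> verts n. length w = m}. \<exists>k. \<not> alive n UNIV (lab \<omega>) k 0 w" by blast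
    then obtain k where k: "\<And>w. w \<in> {w \<in> verts n. length w = m} \<Longrightarrow> \<not> alive n UNIV (lab \<omega>) (k w) 0 w"
      by metis
    define K where "K = Max (insert 0 (k ` {w \<in> verts n. length w = m}))"
    obtain w where w: "w \<in> {w \<in> verts n. length w = m}" "alive n UNIV (lab \<omega>) K 0 w" using G by blast
    have "k w \<le> K" unfolding K_def using w(1) finite_level[of n m] by (intro Max_ge) auto
    then show False using alive_antimono[OF w(2)] k[OF w(1)] by blast
  qed
  have E_ge: "1 - (1 - \<epsilon>) ^ m \<le> prob {\<omega> \<in> space M. ?E \<omega>}" for m
  proof -
    have "m \<le> n ^ m"
      using two_le_n less_exp[of m] power_mono[of 2 n m] by linarith
    then have "1 - (1 - \<epsilon>) ^ m \<le> 1 - (1 - \<epsilon>) ^ (n ^ m)"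
      using \<epsilon> \<epsilon>1 by (simp add: power_decreasing)
    also have "\<dots> \<le> prob {\<omega> \<in> space M. \<forall>k. ?G m k \<omega>}"
    proof (rule le_prob_all[OF meas_G _ G_ge])
      show "?G m k \<omega>" if "?G m (Suc k) \<omega>" for k \<omega>
        using that alive_antimono[of n UNIV "lab \<omega>" "Suc k" 0 _ k] by auto
    qed
    also have "\<dots> \<le> prob {\<omega> \<in> space M. ?E \<omega>}"
      using E_if_G by (intro finite_measure_mono predE meas_E) blast
    finally show ?thesis .
  qed
  have "(\<lambda>m. 1 - (1 - \<epsilon>) ^ m) \<longlonglongrightarrow> 1 - 0"
    using \<epsilon> \<epsilon>1 by (intro tendsto_intros LIMSEQ_power_zero) simp
  then have "1 \<le> prob {\<omega> \<in> space M. ?E \<omega>}" using E_ge LIMSEQ_le_const2 by fastforce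
  then have "prob {\<omega> \<in> space M. ?E \<omega>} = 1" using prob_le_1 antisym by blast
  then have "AE \<omega> in M. ?E \<omega>" using prob_Collect_eq_1[OF predE[OF meas_E]] by blast
  then show ?thesis
    by (rule eventually_mono) (auto intro: infinite_path_if_alive)
qed

lemma survival_Suc_le: "survival \<mu> S n (Suc k) c \<le> survival \<mu> S n k c"
proof -
  have "prob {\<omega> \<in> space M. alive n S (lab \<omega>) (Suc k) c []} \<le>
      prob {\<omega> \<in> space M. alive n S (lab \<omega>) k c []}"
    by (intro finite_measure_mono predE measurable_alive) (auto intro: alive_antimono)
  then show ?thesis by (simp only: prob_alive[OF Nil_in_verts])
qed

text \<open>Almost surely every label has positive probability, so only covers \<open>c\<close> below a possible label are
ever inherited. For each of these, a subtree survives with probability zero by comparison with a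
root labelled above \<open>c\<close>.\<close>

lemma AE_no_infinite_path_if_not_supercritical:
  assumes "\<not> supercritical \<mu> UNIV n"
  shows "AE \<omega> in M. \<not> contains_infinite_path n (covered n (lab \<omega>))"
proof -
  have dead: "AE \<omega> in M. \<exists>k. \<not> alive n UNIV (lab \<omega>) k c v"
    if v: "v \<in> verts n" and c: "c = 0 \<or> (\<exists>y>c. 0 < pmf \<mu> y)" for v c
  proof -
    define p where "p = prob {\<omega> \<in> space M. \<forall>k. alive n UNIV (lab \<omega>) k c v}"
    have p_le: "p \<le> survival \<mu> UNIV n k c" for k
      unfolding p_def by (rule prob_always_alive_le[OF v])
    have "p \<le> 0"
    proof (rule ccontr)
      assume "\<not> p \<le> 0"
      then have p: "0 < p" by simp
      show False
      proof (cases "c = 0")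
        case True
        obtain k where "survival \<mu> UNIV n k 0 < p"
          using survival_le_if_not_supercritical[OF two_le_n assms p] by blast
        then show False using p_le[of k] True by simp
      next
        case False
        then obtain y where y: "c < y" "0 < pmf \<mu> y" using c by blast
        then have "0 < pmf \<mu> y * p" using p by simp
        then obtain k where k: "survival \<mu> UNIV n k 0 < pmf \<mu> y * p"
          using survival_le_if_not_supercritical[OF two_le_n assms] by blast
        have "pmf \<mu> y * p \<le> pmf \<mu> y * survival \<mu> UNIV n k c"
          using p_le by (intro mult_left_mono) auto
        also have "\<dots> \<le> survival \<mu> UNIV n (Suc k) 0"
          using two_le_n by (intro pmf_mult_survival_le y(1)) simp
        also have "\<dots> \<le> survival \<mu> UNIV n k 0" by (rule survival_Suc_le)
        finally show False using k by linarith
      qed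
    qed
    then have "AE \<omega> in M. \<not> (\<forall>k. alive n UNIV (lab \<omega>) k c v)"
      unfolding p_def by (rule AE_not_if_prob_le_0[OF measurable_always_alive[OF v]])
    then show ?thesis by (rule eventually_mono) blast
  qed
  have label_pos: "AE \<omega> in M. 0 < pmf \<mu> (Y x \<omega>)" if x: "x \<in> verts n" for x
  proof -
    have "AE \<omega> in M. \<forall>y\<in>- set_pmf \<mu>. Y x \<omega> \<noteq> y"
    proof (rule AE_ball_countable')
      fix y assume "y \<in> - set_pmf \<mu>"
      then have "prob {\<omega> \<in> space M. Y x \<omega> = y} \<le> 0" using law[OF x, of y] by (simp add: set_pmf_iff)
      moreover have "Measurable.pred M (\<lambda>\<omega>. Y x \<omega> = y)"
        using measurable_label[OF x] by measurable
      ultimately show "AE \<omega> in M. Y x \<omega> \<noteq> y" by (intro AE_not_if_prob_le_0)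
    qed simp
    then show ?thesis by (rule eventually_mono) (auto intro: pmf_positive)
  qed
  have "AE \<omega> in M. \<forall>x\<in>verts n. 0 < pmf \<mu> (Y x \<omega>)"
    by (rule AE_ball_countable'[OF label_pos]) simp_all
  moreover have "AE \<omega> in M. \<forall>v\<in>verts n. \<forall>c\<in>{c. c = 0 \<or> (\<exists>y>c. 0 < pmf \<mu> y)}.
      \<exists>k. \<not> alive n UNIV (lab \<omega>) k c v"
    by (rule AE_ball_countable', rule AE_ball_countable', rule dead) simp_all
  ultimately show ?thesis
  proof eventually_elim
    case (elim \<omega>)
    show ?case
    proof
      assume "contains_infinite_path n (covered n (lab \<omega>))"
      then obtain v c where "v \<in> verts n" "\<And>k. alive n UNIV (lab \<omega>) k c v"
        "c = 0 \<or> (\<exists>x\<in>verts n. c < Y x \<omega>)"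
        by (rule alive_if_infinite_path) blast
      then show False using elim by blast
    qed
  qed
qed

lemma infinite_path_iff_supercritical:
  "(AE \<omega> in M. contains_infinite_path n (covered n (lab \<omega>))) \<longleftrightarrow> supercritical \<mu> UNIV n"
proof
  assume A: "AE \<omega> in M. contains_infinite_path n (covered n (lab \<omega>))"
  show "supercritical \<mu> UNIV n"
  proof (rule ccontr)
    assume "\<not> ?thesis"
    from A AE_no_infinite_path_if_not_supercritical[OF this] have "AE \<omega> in M. False"
      by eventually_elim simp
    then show False by simp
  qed
qed (rule AE_infinite_path_if_supercritical)

end

theorem theorem3:
  fixes n :: nat and \<mu> :: "nat pmf"
    and M :: "'a measure" and Y :: "nat list \<Rightarrow> 'a \<Rightarrow> nat"
  assumes "n \<ge> 2"
    and "0 < pmf \<mu> 0" and "pmf \<mu> 0 < 1"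
    and "prob_space M"
    and "prob_space.indep_vars M (\<lambda>_. count_space UNIV) Y (verts n)"
    and "\<And>x k. x \<in> verts n \<Longrightarrow> measure M {\<omega> \<in> space M. Y x \<omega> = k} = pmf \<mu> k"
  defines "A \<equiv> (AE \<omega> in M. contains_infinite_path n (covered n (\<lambda>x. Y x \<omega>)))"
    and "B \<equiv> measure M {\<omega> \<in> space M. \<not> dies_out_globally n (\<lambda>x. Y x \<omega>)} > 0"
    and "C \<equiv> measure M {\<omega> \<in> space M. \<not> dies_out_locally n \<mu> (\<lambda>x. Y x \<omega>)} > 0"
    and "D \<equiv> rho_M \<mu> > ereal (1 / real n)"
  shows "(AE \<omega> in M. infinite (uncovered n (\<lambda>x. Y x \<omega>))) \<and>
         (A \<longleftrightarrow> B) \<and> (B \<longleftrightarrow> C) \<and> (C \<longleftrightarrow> D)"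
proof -
  interpret prob_space M by fact
  interpret percolation M n \<mu> Y by unfold_locales fact+
  have "A \<longleftrightarrow> supercritical \<mu> UNIV n"
    unfolding A_def by (rule infinite_path_iff_supercritical)
  moreover have "B \<Longrightarrow> supercritical \<mu> UNIV n"
    unfolding B_def by (rule supercritical_if_survives_globally)
  moreover have "supercritical \<mu> UNIV n \<Longrightarrow> C"
    unfolding C_def by (rule survives_locally_if_supercritical)
  moreover have "C \<Longrightarrow> B"
    unfolding B_def C_def by (rule survives_globally_if_locally)
  moreover have "D \<longleftrightarrow> supercritical \<mu> UNIV n"
    unfolding D_def using rho_M_gt_iff_supercritical two_le_n by simp
  ultimately show ?thesis using AE_infinite_uncovered by blast
qed

end
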